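(* Let $S$ be a semitopological semigroup (with neutral element). Every tame compact $S$-space $X$ is injective. Hence, every affine $S$-compactification of a tame (compact) $S$-system is $E$-compatible.
   Context: Spaces are Hausdorff, vector spaces real. $S$ is a monoid with separately continuous multiplication. A compact $S$-space ($S$-system) is a compact space with a separately continuous monoidal action of $S$; its enveloping semigroup $E(X)$ is the pointwise closure in $X^X$ of the translations. A map $f:X\to Y$ from a topological space to a uniform space is fragmented if for every nonempty $A\subset X$ and entourage $\varepsilon$ there is an open $O\subset X$ with $O\cap A\neq\emptyset$ and $f(O\cap A)$ $\varepsilon$-small (i.e. $f(O\cap A)\times f(O\cap A)\subset\varepsilon$); compact spaces carry the unique compatible uniformity. A compact $S$-system $X$ is tame if every $p\in E(X)$ is a fragmented map $X\to X$. An affine $S$-compactification of $X$ is a continuous $S$-map $\alpha:X\to Q$, where $Q$ is a compact convex subset of a locally convex space with a separately continuous action of $S$ by affine maps, and $Q=\overline{co}(\alpha(X))$. It is $E$-compatible if the restriction homomorphism $E(Q)\to E(Y)$, $p\mapsto p|_Y$, with $Y:=\overline{\alpha(X)}$, is injective (equivalently an isomorphism). A compact $S$-system $X$ is WRUC if for every $f\in C(X)$ the map $S\to C(X)$, $s\mapsto fs$, $(fs)(x)=f(sx)$, is continuous for the weak topology of $C(X)$; equivalently, the induced action on the space $P(X)$ of probability measures (weak$^*$ topology) is separately continuous. A compact $S$-system $X$ is injective if it is WRUC and the affine $S$-compactification $X\to P(X)$, $x\mapsto\delta_x$, is $E$-compatible. *)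

theory Defs
  imports "HOL-Probability.Probability"
begin

section \<open>Semitopological monoids and locally convex spaces\<close>

class semitopological_monoid = t2_space + monoid_mult +
  assumes tendsto_mult_left_nhds: "((\<lambda>x. s * x) \<longlongrightarrow> s * t) (nhds t)"
    and tendsto_mult_right_nhds: "((\<lambda>x. x * s) \<longlongrightarrow> t * s) (nhds t)"

lemma semitopological_monoid_continuous_on:
  fixes s :: "'s::semitopological_monoid"
  shows "continuous_on UNIV (\<lambda>x. s * x)" and "continuous_on UNIV (\<lambda>x. x * s)"
  unfolding continuous_on_def
  by (auto simp: at_within_def intro: tendsto_mono[OF inf_le1]
      tendsto_mult_left_nhds tendsto_mult_right_nhds)

text \<open>The constant \<^const>\<open>convex\<close> cannot be used inside a class specification, so the second
  axiom is its unfolding; see \<open>locally_convex_nhds_base\<close>.\<close>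

class locally_convex_space = t2_space + topological_ab_group_add + real_vector +
  assumes tendsto_scaleR_nhds:
      "((\<lambda>p. fst p *\<^sub>R snd p) \<longlongrightarrow> r *\<^sub>R x) (nhds r \<times>\<^sub>F nhds x)"
    and convex_nhds_base:
      "open U \<Longrightarrow> 0 \<in> U \<Longrightarrow> \<exists>V. open V \<and> 0 \<in> V \<and> V \<subseteq> U \<and>
         (\<forall>x\<in>V. \<forall>y\<in>V. \<forall>u\<ge>0. \<forall>v\<ge>0. u + v = 1 \<longrightarrow> u *\<^sub>R x + v *\<^sub>R y \<in> V)"

lemma locally_convex_nhds_base:
  fixes U :: "'v::locally_convex_space set"
  assumes "open U" "0 \<in> U"
  shows "\<exists>V. open V \<and> 0 \<in> V \<and> V \<subseteq> U \<and> convex V"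
  using convex_nhds_base[OF assms] unfolding convex_def .


section \<open>Compact systems and enveloping semigroups\<close>

definition compact_system ::
    "'a topology \<Rightarrow> ('s::semitopological_monoid \<Rightarrow> 'a \<Rightarrow> 'a) \<Rightarrow> bool" where
  "compact_system X act \<longleftrightarrow>
     compact_space X \<and> Hausdorff_space X \<and>
     (\<forall>x\<in>topspace X. act 1 x = x) \<and>
     (\<forall>s t. \<forall>x\<in>topspace X. act (s * t) x = act s (act t x)) \<and>
     (\<forall>s. continuous_map X X (act s)) \<and>
     (\<forall>x\<in>topspace X. continuous_map euclidean X (\<lambda>s. act s x))"

text \<open>Elements of \<open>X\<^sup>X\<close> are represented by extensional functions, as in
  \<^const>\<open>product_topology\<close>.\<close>

definition enveloping_semigroup :: "'a topology \<Rightarrow> ('s \<Rightarrow> 'a \<Rightarrow> 'a) \<Rightarrow> ('a \<Rightarrow> 'a) set" where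
  "enveloping_semigroup X act =
     product_topology (\<lambda>_. X) (topspace X) closure_of range (\<lambda>s. restrict (act s) (topspace X))"


section \<open>Fragmented maps and tameness\<close>

text \<open>The unique compatible uniformity of a compact Hausdorff space consists of all
  neighbourhoods of the diagonal; see \<open>entourages_eq_uniformity\<close> below.\<close>

definition entourages :: "'a topology \<Rightarrow> ('a \<times> 'a) set set" where
  "entourages X = {E. E \<subseteq> topspace X \<times> topspace X \<and>
     (\<exists>W. openin (prod_topology X X) W \<and> (\<forall>x\<in>topspace X. (x, x) \<in> W) \<and> W \<subseteq> E)}"

lemma entourages_eq_uniformity:
  assumes "compact (UNIV :: 'a::{uniform_space, t2_space} set)"
  shows "entourages (euclidean :: 'a topology) = {E. \<forall>\<^sub>F z in uniformity. z \<in> E}"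
proof (intro set_eqI iffI)
  fix E :: "('a \<times> 'a) set"
  assume "E \<in> entourages euclidean"
  then obtain W where W: "open W" "\<And>x. (x, x) \<in> W" "W \<subseteq> E"
    unfolding entourages_def by (auto simp: euclidean_product_topology)
  have "\<forall>x. \<exists>A B. open A \<and> open B \<and> x \<in> A \<and> x \<in> B \<and> A \<times> B \<subseteq> W"
    proof
    fix x
    from open_prod_elim[OF W(1) W(2)[of x]] show
      "\<exists>A B. open A \<and> open B \<and> x \<in> A \<and> x \<in> B \<and> A \<times> B \<subseteq> W"
      by (metis mem_Sigma_iff)
  qed
  then obtain A B where AB: "\<And>x. open (A x)" "\<And>x. open (B x)" "\<And>x. x \<in> A x" "\<And>x. x \<in> B x"
    "\<And>x. A x \<times> B x \<subseteq> W" by metis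
  have "\<exists>D. eventually D uniformity \<and> (\<forall>y z. D (x, y) \<longrightarrow> D (y, z) \<longrightarrow> y \<in> A x \<and> z \<in> B x)" for x
  proof -
    have "open (A x \<inter> B x)" "x \<in> A x \<inter> B x" using AB by auto
    then have "\<forall>\<^sub>F (x', y) in uniformity. x' = x \<longrightarrow> y \<in> A x \<inter> B x"
      unfolding open_uniformity by blast
    then obtain D where D: "eventually D uniformity"
      "\<And>a b c. D (a, b) \<Longrightarrow> D (b, c) \<Longrightarrow> (case (a, c) of (x', y) \<Rightarrow> x' = x \<longrightarrow> y \<in> A x \<inter> B x)"
      by (erule uniformity_transE)
    have "y \<in> A x \<and> z \<in> B x" if "D (x, y)" "D (y, z)" for y z
      using D(2)[OF that] D(2)[OF that(1) uniformity_refl[OF D(1)]] by simp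
    with D(1) show ?thesis by blast
  qed
  then obtain D where D: "\<And>x. eventually (D x) uniformity"
    "\<And>x y z. D x (x, y) \<Longrightarrow> D x (y, z) \<Longrightarrow> y \<in> A x \<and> z \<in> B x"
    by metis
  have "\<exists>U. open U \<and> x \<in> U \<and> (\<forall>y\<in>U. D x (x, y))" for x
  proof -
    have "\<forall>\<^sub>F y in nhds x. D x (x, y)"
      unfolding eventually_nhds_uniformity using D(1)[of x] by (rule eventually_mono) auto
    then show ?thesis unfolding eventually_nhds by blast
  qed
  then obtain U where U: "\<And>x. open (U x)" "\<And>x. x \<in> U x" "\<And>x y. y \<in> U x \<Longrightarrow> D x (x, y)"
    by metis
  obtain F where F: "finite F" "UNIV \<subseteq> (\<Union>x\<in>F. U x)"
    by (rule compactE_image[OF assms, of UNIV U]) (use U in auto)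
  have "\<forall>\<^sub>F z in uniformity. \<forall>x\<in>F. D x z"
    using F(1) D(1) by (simp add: eventually_ball_finite)
  then show "E \<in> {E. \<forall>\<^sub>F z in uniformity. z \<in> E}"
    unfolding mem_Collect_eq
  proof (rule eventually_mono)
    fix z :: "'a \<times> 'a" assume z: "\<forall>x\<in>F. D x z"
    obtain x where "x \<in> F" "fst z \<in> U x" using F by auto
    then have "fst z \<in> A x \<and> snd z \<in> B x" using U(3)[of "fst z" x] D(2)[of x "fst z" "snd z"] z by simp
    then show "z \<in> E" using AB(5)[of x] W(3) by (cases z) auto
  qed
next
  fix E :: "('a \<times> 'a) set"
  assume "E \<in> {E. \<forall>\<^sub>F z in uniformity. z \<in> E}"
  then have E: "\<forall>\<^sub>F z in uniformity. z \<in> E" by simp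
  then obtain D where D: "eventually D uniformity"
    "\<And>a b c. D (a, b) \<Longrightarrow> D (b, c) \<Longrightarrow> (a, c) \<in> E"
    by (erule uniformity_transE)
  have "\<exists>U. open U \<and> x \<in> U \<and> U \<times> U \<subseteq> E" for x
  proof -
    have "\<forall>\<^sub>F z in uniformity. D z \<and> D (snd z, fst z)"
      using eventually_conj[OF D(1) uniformity_sym[OF D(1)]] by (rule eventually_mono) auto
    then have "\<forall>\<^sub>F y in nhds x. D (x, y) \<and> D (y, x)"
      unfolding eventually_nhds_uniformity by (rule eventually_mono) auto
    then obtain U where "open U" "x \<in> U" "\<And>y. y \<in> U \<Longrightarrow> D (x, y) \<and> D (y, x)"
      unfolding eventually_nhds by blast
    then show ?thesis using D(2) by (intro exI[of _ U]) blast
  qed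
  then obtain U where U: "\<And>x. open (U x)" "\<And>x. x \<in> U x" "\<And>x. U x \<times> U x \<subseteq> E" by metis
  have "open (\<Union>x. U x \<times> U x)" using U by (intro open_UN ballI open_Times) auto
  moreover have "(x, x) \<in> (\<Union>x. U x \<times> U x)" for x using U(2) by blast
  moreover have "(\<Union>x. U x \<times> U x) \<subseteq> E" using U(3) by blast
  ultimately have "\<exists>W. open W \<and> (\<forall>x. (x, x) \<in> W) \<and> W \<subseteq> E" by blast
  then show "E \<in> entourages euclidean"
    by (simp add: entourages_def euclidean_product_topology)
qed

definition fragmented_map ::
    "'a topology \<Rightarrow> ('b \<times> 'b) set set \<Rightarrow> ('a \<Rightarrow> 'b) \<Rightarrow> bool" where
  "fragmented_map X \<U> f \<longleftrightarrow>
     (\<forall>A E. A \<subseteq> topspace X \<and> A \<noteq> {} \<and> E \<in> \<U> \<longrightarrow>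
        (\<exists>V. openin X V \<and> V \<inter> A \<noteq> {} \<and> f ` (V \<inter> A) \<times> f ` (V \<inter> A) \<subseteq> E))"

definition tame :: "'a topology \<Rightarrow> ('s::semitopological_monoid \<Rightarrow> 'a \<Rightarrow> 'a) \<Rightarrow> bool" where
  "tame X act \<longleftrightarrow> (\<forall>p\<in>enveloping_semigroup X act. fragmented_map X (entourages X) p)"


section \<open>Affine compactifications and \<open>E\<close>-compatibility\<close>

definition affine_map_on :: "'v::real_vector set \<Rightarrow> ('v \<Rightarrow> 'v) \<Rightarrow> bool" where
  "affine_map_on Q g \<longleftrightarrow>
     (\<forall>x\<in>Q. \<forall>y\<in>Q. \<forall>u\<ge>0. \<forall>v\<ge>0. u + v = 1 \<longrightarrow> g (u *\<^sub>R x + v *\<^sub>R y) = u *\<^sub>R g x + v *\<^sub>R g y)"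

definition affine_compactification ::
    "'a topology \<Rightarrow> ('s::semitopological_monoid \<Rightarrow> 'a \<Rightarrow> 'a) \<Rightarrow>
     'v::locally_convex_space set \<Rightarrow> ('s \<Rightarrow> 'v \<Rightarrow> 'v) \<Rightarrow> ('a \<Rightarrow> 'v) \<Rightarrow> bool" where
  "affine_compactification X act Q actQ \<alpha> \<longleftrightarrow>
     compact Q \<and> convex Q \<and>
     compact_system (top_of_set Q) actQ \<and>
     (\<forall>s. affine_map_on Q (actQ s)) \<and>
     continuous_map X (top_of_set Q) \<alpha> \<and>
     (\<forall>s. \<forall>x\<in>topspace X. \<alpha> (act s x) = actQ s (\<alpha> x)) \<and>
     Q = closure (convex hull (\<alpha> ` topspace X))"

text \<open>With \<open>Y\<close> the closure of the image of \<open>\<alpha>\<close> in \<open>Q\<close>, restriction to \<open>Y\<close> maps the enveloping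
  semigroup of \<open>Q\<close> to that of \<open>Y\<close>.  Injectivity does not depend on naming the codomain.\<close>

definition E_compatible ::
    "'a topology \<Rightarrow> 'q topology \<Rightarrow> ('s::semitopological_monoid \<Rightarrow> 'q \<Rightarrow> 'q) \<Rightarrow> ('a \<Rightarrow> 'q) \<Rightarrow> bool" where
  "E_compatible X Q actQ \<alpha> \<longleftrightarrow>
     inj_on (\<lambda>p. restrict p (Q closure_of (\<alpha> ` topspace X))) (enveloping_semigroup Q actQ)"


section \<open>Weakly right uniformly continuous systems\<close>

definition weak_topology :: "'b::real_normed_vector topology" where
  "weak_topology = pullback_topology UNIV (\<lambda>v (\<Lambda> :: 'b \<Rightarrow>\<^sub>L real). blinfun_apply \<Lambda> v)
     (product_topology (\<lambda>_. euclideanreal) UNIV)"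

text \<open>For a compact space given as a whole type, the type of bounded continuous functions
  is the Banach space \<open>C(X)\<close>.\<close>

definition WRUC :: "('s::semitopological_monoid \<Rightarrow> 'a::t2_space \<Rightarrow> 'a) \<Rightarrow> bool" where
  "WRUC act \<longleftrightarrow>
     (\<forall>f :: 'a \<Rightarrow>\<^sub>C real.
        continuous_map euclidean weak_topology (\<lambda>s. Bcontfun (\<lambda>x. apply_bcontfun f (act s x))))"


section \<open>The space of probability measures\<close>

text \<open>As usual for compact spaces that need not be metrizable, \<open>P(X)\<close> consists of the
  regular Borel probability measures.  For finite measures on a compact Hausdorff space, inner
  regularity by compact sets on all Borel sets already gives outer regularity.\<close>

definition prob_measures :: "'a::t2_space measure set" where
  "prob_measures = {\<mu>. prob_space \<mu> \<and> sets \<mu> = sets borel \<and>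
     (\<forall>B\<in>sets borel. emeasure \<mu> B = (SUP K\<in>{K. K \<subseteq> B \<and> compact K}. emeasure \<mu> K))}"

definition prob_topology :: "'a::t2_space measure topology" where
  "prob_topology = pullback_topology prob_measures
     (\<lambda>\<mu> (f :: 'a \<Rightarrow>\<^sub>C real). \<integral>x. apply_bcontfun f x \<partial>\<mu>)
     (product_topology (\<lambda>_. euclideanreal) UNIV)"

definition prob_action :: "('s \<Rightarrow> 'a::t2_space \<Rightarrow> 'a) \<Rightarrow> 's \<Rightarrow> 'a measure \<Rightarrow> 'a measure" where
  "prob_action act s \<mu> = distr \<mu> borel (act s)"

definition injective_system :: "('s::semitopological_monoid \<Rightarrow> 'a::t2_space \<Rightarrow> 'a) \<Rightarrow> bool" where
  "injective_system act \<longleftrightarrow>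
     compact_system euclidean act \<and> WRUC act \<and>
     E_compatible euclidean prob_topology (prob_action act) (\<lambda>x. return borel x)"

end

theory Submission
  imports Defs
begin

text \<open>
  Let \<open>p\<close> and \<open>q\<close> be elements of the enveloping semigroup of an affine system \<open>Q\<close> that agree on the
  image of \<open>X\<close>. A point \<open>y\<close> of \<open>Q\<close> is the barycenter of a probability measure \<open>\<mu>\<close> on \<open>X\<close>, and for a
  translation by \<open>s\<close> and a continuous affine function \<open>h\<close> on \<open>Q\<close> the value \<open>h (s y)\<close> is the
  \<open>\<mu>\<close>-integral of a function \<open>f \<circ> s\<close> on \<open>X\<close>, where \<open>f\<close> is the composition of \<open>h\<close> with the map
  from \<open>X\<close> to \<open>Q\<close>. When \<open>s\<close> tends to \<open>p\<close> and \<open>t\<close> tends to \<open>q\<close>, the functions \<open>f \<circ> s - f \<circ> t\<close> tend to \<open>0\<close> pointwise, and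
  \<open>h (p y) = h (q y)\<close> follows if limit and integral can be interchanged. The same interchange, with
  \<open>t\<close> fixed and \<open>s\<close> tending to \<open>t\<close>, is weak continuity of the orbit maps, that is WRUC. So all claims
  reduce to a dominated convergence theorem for translates of \<open>f\<close> along filters
  (\<open>tame_dominated_convergence\<close>).

  Dominated convergence fails for general filters, and this is where tameness enters. If the
  translates of \<open>f\<close> contained an independent sequence, then a cluster point \<open>p\<close> of the corresponding
  translations would yield a function \<open>f \<circ> p\<close> that oscillates on every nonempty relatively open
  subset of a suitable closed set, contrary to fragmentability of \<open>p\<close>
  (\<open>tame_no_independent_sequence\<close>). Without independent
  sequences the translates have the Bourgain property: every nonempty closed set has finitely many
  nonempty relatively open pieces such that each translate has small oscillation on one of them
  (\<open>tame_small_oscillation\<close>). An exhaustion argument, in which such pieces are cut off from a minimal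
  closed set, then proves convergence of the integrals (\<open>dominated_convergence\<close>).

  Measures are used only through positive functionals on the cone of nonnegative continuous
  functions. For WRUC the functional is the variation of a bounded functional on \<open>C(X)\<close>, for \<open>P(X)\<close> it
  is integration, and for a general \<open>Q\<close> it comes from the Hahn-Banach theorem
  (\<open>barycenter_functional\<close>). The Hahn-Banach theorem also shows that the continuous linear functionals separate
  the points of \<open>Q\<close>; the points of \<open>P(X)\<close> are separated by the integrals of continuous functions.
\<close>


section \<open>Compact Hausdorff spaces\<close>

lemma compact_Urysohn:
  fixes A B :: "'a::t2_space set"
  assumes X: "compact (UNIV :: 'a set)" and "closed A" "closed B" "A \<inter> B = {}"
  obtains f :: "'a \<Rightarrow> real" where "continuous_on UNIV f" "\<And>x. 0 \<le> f x" "\<And>x. f x \<le> 1"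
    "\<And>x. x \<in> A \<Longrightarrow> f x = 0" "\<And>x. x \<in> B \<Longrightarrow> f x = 1"
proof -
  have "Hausdorff_space (euclidean :: 'a topology)"
    by (auto simp: Hausdorff_space_def disjnt_def) (metis hausdorff)
  moreover have "compact_space (euclidean :: 'a topology)"
    using X by (simp add: compact_space_def)
  ultimately have "normal_space (euclidean :: 'a topology)"
    by (simp add: compact_Hausdorff_or_regular_imp_normal_space)
  then obtain f where f: "continuous_map euclidean (top_of_set {0..1::real}) f" "f ` A \<subseteq> {0}" "f ` B \<subseteq> {1}"
    using Urysohn_lemma[of "euclidean :: 'a topology" A B 0 1] assms by (auto simp: disjnt_def)
  then show thesis
    by (intro that[of f]) (auto simp: continuous_map_in_subtopology)
qed

text \<open>Zorn's lemma for closed sets; in a compact space the premise on chains is usually supplied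
  by the finite intersection property.\<close>

lemma minimal_closed_subset:
  fixes A :: "'a::topological_space set"
  assumes "closed A" "P A"
    and chain: "\<And>\<C>. \<C> \<noteq> {} \<Longrightarrow> (\<And>Z. Z \<in> \<C> \<Longrightarrow> closed Z \<and> P Z) \<Longrightarrow>
      (\<And>Y Z. Y \<in> \<C> \<Longrightarrow> Z \<in> \<C> \<Longrightarrow> Y \<subseteq> Z \<or> Z \<subseteq> Y) \<Longrightarrow> P (\<Inter>\<C>)"
  obtains Z where "closed Z" "Z \<subseteq> A" "P Z"
    "\<And>Y. closed Y \<Longrightarrow> Y \<subseteq> Z \<Longrightarrow> P Y \<Longrightarrow> Y = Z"
proof -
  define \<O> where "\<O> = {U. open U \<and> - A \<subseteq> U \<and> P (- U)}"
  have "\<exists>M\<in>\<O>. \<forall>U\<in>\<O>. M \<subseteq> U \<longrightarrow> U = M"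
  proof (rule subset_Zorn_nonempty)
    show "\<O> \<noteq> {}" using assms(1,2) by (auto simp: \<O>_def intro!: exI[of _ "- A"])
  next
    fix \<U> assume ne: "\<U> \<noteq> {}" and ch: "subset.chain \<O> \<U>"
    have U: "open U" "- A \<subseteq> U" "P (- U)" if "U \<in> \<U>" for U
      using ch that by (auto simp: subset_chain_def \<O>_def)
    have tot: "U \<subseteq> V \<or> V \<subseteq> U" if "U \<in> \<U>" "V \<in> \<U>" for U V
      using ch that by (auto simp: subset_chain_def)
    have "P (\<Inter> (uminus ` \<U>))"
    proof (rule chain)
      show "Y \<subseteq> Z \<or> Z \<subseteq> Y" if "Y \<in> uminus ` \<U>" "Z \<in> uminus ` \<U>" for Y Z
        using that tot by (metis Compl_subset_Compl_iff imageE)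
    qed (use ne U in \<open>auto simp: closed_def\<close>)
    moreover have "\<Inter> (uminus ` \<U>) = - \<Union>\<U>" by auto
    ultimately show "\<Union>\<U> \<in> \<O>" using ne U unfolding \<O>_def by fastforce
  qed
  then obtain M where M: "M \<in> \<O>" "\<And>U. U \<in> \<O> \<Longrightarrow> M \<subseteq> U \<Longrightarrow> U = M" by blast
  show thesis
  proof (rule that[of "- M"])
    fix Y assume "closed Y" "Y \<subseteq> - M" "P Y"
    then show "Y = - M" using M(2)[of "- Y"] M(1) by (auto simp: \<O>_def)
  qed (use M in \<open>auto simp: \<O>_def\<close>)
qed

lemma chain_Inter_subset_open:
  fixes \<C> :: "'a::topological_space set set"
  assumes X: "compact (UNIV :: 'a set)" and "\<C> \<noteq> {}" and cl: "\<And>Z. Z \<in> \<C> \<Longrightarrow> closed Z"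
    and tot: "\<And>Y Z. Y \<in> \<C> \<Longrightarrow> Z \<in> \<C> \<Longrightarrow> Y \<subseteq> Z \<or> Z \<subseteq> Y"
    and "open V" "\<Inter>\<C> \<subseteq> V"
  shows "\<exists>Z\<in>\<C>. Z \<subseteq> V"
proof (rule ccontr)
  assume no: "\<not> ?thesis"
  have "(- V) \<inter> \<Inter>\<C> \<noteq> {}"
  proof (rule compact_imp_fip)
    show "compact (- V)" using compact_Int_closed[OF X, of "- V"] \<open>open V\<close> by (simp add: closed_def)
    fix F assume F: "finite F" "F \<subseteq> \<C>"
    show "- V \<inter> \<Inter>F \<noteq> {}"
    proof (cases "F = {}")
      case True
      then show ?thesis using no \<open>\<C> \<noteq> {}\<close> by auto
    next
      case False
      have "\<Inter>F \<in> F" using F False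
        by (intro Inter_in_chain) (use tot in \<open>auto simp: subset_chain_def\<close>)
      then show ?thesis using no F by blast
    qed
  qed (use cl in auto)
  then show False using \<open>\<Inter>\<C> \<subseteq> V\<close> by blast
qed


lemma compact_bounded:
  fixes u :: "'a::topological_space \<Rightarrow> real"
  assumes "compact (UNIV :: 'a set)" "continuous_on UNIV u"
  obtains M where "0 \<le> M" "\<And>x. \<bar>u x\<bar> \<le> M"
proof -
  have "bounded (range u)" using compact_continuous_image[OF assms(2,1)] by (rule compact_imp_bounded)
  then obtain M where M: "\<And>x. \<bar>u x\<bar> \<le> M" by (meson bounded_real rangeI)
  then show thesis using that order_trans[OF abs_ge_zero] by blast
qed

lemma apply_Bcontfun:
  fixes u :: "'a::topological_space \<Rightarrow> real"
  assumes "compact (UNIV :: 'a set)" "continuous_on UNIV u"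
  shows "apply_bcontfun (Bcontfun u) = u"
  using assms compact_continuous_image[OF assms(2,1)]
  by (intro Bcontfun_inverse) (auto simp: bcontfun_def compact_imp_bounded)


section \<open>Positive functionals and dominated convergence\<close>

text \<open>Only the values on nonnegative continuous functions are constrained, because the variation of a
  signed functional is given by a natural formula only on this cone.\<close>

locale cone_functional =
  fixes L :: "('a::t2_space \<Rightarrow> real) \<Rightarrow> real"
  assumes add: "\<lbrakk>continuous_on UNIV u; continuous_on UNIV v; \<And>x. 0 \<le> u x; \<And>x. 0 \<le> v x\<rbrakk> \<Longrightarrow>
      L (\<lambda>x. u x + v x) = L u + L v"
    and scale: "\<lbrakk>continuous_on UNIV u; \<And>x. 0 \<le> u x; 0 \<le> c\<rbrakk> \<Longrightarrow> L (\<lambda>x. c * u x) = c * L u"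
    and nonneg: "\<lbrakk>continuous_on UNIV u; \<And>x. 0 \<le> u x\<rbrakk> \<Longrightarrow> 0 \<le> L u"
begin

lemma mono:
  assumes "continuous_on UNIV u" "continuous_on UNIV v" "\<And>x. 0 \<le> u x" "\<And>x. u x \<le> v x"
  shows "L u \<le> L v"
proof -
  have "L (\<lambda>x. u x + (v x - u x)) = L u + L (\<lambda>x. v x - u x)"
    using assms by (intro add) (auto intro!: continuous_intros)
  moreover have "0 \<le> L (\<lambda>x. v x - u x)" using assms by (intro nonneg) (auto intro!: continuous_intros)
  ultimately show ?thesis by simp
qed

lemma zero: "L (\<lambda>x. 0) = 0"
  using scale[of "\<lambda>x. 0" 0] by simp

definition majorants :: "'a set \<Rightarrow> ('a \<Rightarrow> real) \<Rightarrow> ('a \<Rightarrow> real) set" where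
  "majorants A u = {v. continuous_on UNIV v \<and> (\<forall>x. 0 \<le> v x) \<and> (\<forall>x\<in>A. u x \<le> v x)}"

text \<open>If \<open>L\<close> is the integral against a Radon measure \<open>\<mu>\<close>, this is the integral of the nonnegative
  continuous function \<open>u\<close> over the closed set \<open>A\<close>. These integrals are all that is needed of \<open>\<mu>\<close>.\<close>

definition upper_integral :: "'a set \<Rightarrow> ('a \<Rightarrow> real) \<Rightarrow> real" where
  "upper_integral A u = (INF v\<in>majorants A u. L v)"

lemma bdd_below_majorants: "bdd_below (L ` majorants A u)"
  by (rule bdd_belowI[of _ 0]) (auto simp: majorants_def intro: nonneg)

lemma upper_integral_le: "v \<in> majorants A u \<Longrightarrow> upper_integral A u \<le> L v"
  unfolding upper_integral_def by (rule cINF_lower[OF bdd_below_majorants])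

lemma self_majorant: "continuous_on UNIV u \<Longrightarrow> (\<And>x. 0 \<le> u x) \<Longrightarrow> u \<in> majorants A u"
  by (auto simp: majorants_def)

lemma upper_integral_approx:
  assumes "continuous_on UNIV u" "\<And>x. 0 \<le> u x" "0 < e"
  obtains v where "v \<in> majorants A u" "L v < upper_integral A u + e"
proof -
  have "\<exists>v\<in>majorants A u. L v < upper_integral A u + e"
    unfolding upper_integral_def
    by (subst cINF_less_iff[symmetric]) (use assms self_majorant[of u A] bdd_below_majorants in auto)
  then show thesis using that by blast
qed

lemma upper_integral_mono_set:
  assumes "continuous_on UNIV u" "\<And>x. 0 \<le> u x" "A \<subseteq> B"
  shows "upper_integral A u \<le> upper_integral B u"
  unfolding upper_integral_def
proof (rule cINF_superset_mono)
  show "majorants B u \<noteq> {}" using self_majorant[of u B] assms by blast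
qed (use assms bdd_below_majorants in \<open>auto simp: majorants_def\<close>)

lemma upper_integral_UNIV: "continuous_on UNIV u \<Longrightarrow> (\<And>x. 0 \<le> u x) \<Longrightarrow> upper_integral UNIV u = L u"
proof (rule antisym)
  assume u: "continuous_on UNIV u" "\<And>x. 0 \<le> u x"
  show "upper_integral UNIV u \<le> L u" by (intro upper_integral_le self_majorant u)
  show "L u \<le> upper_integral UNIV u" unfolding upper_integral_def
    by (rule cINF_greatest) (use u self_majorant[of u UNIV] in \<open>auto simp: majorants_def intro: mono\<close>)
qed

lemma upper_integral_empty: "upper_integral {} u = 0"
proof -
  have "(\<lambda>x. 0) \<in> majorants {} u" by (simp add: majorants_def)
  then have "upper_integral {} u \<le> 0" using upper_integral_le zero by fastforce
  moreover have "0 \<le> upper_integral {} u" unfolding upper_integral_def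
    by (rule cINF_greatest) (use \<open>(\<lambda>x. 0) \<in> majorants {} u\<close> in blast, auto simp: majorants_def intro: nonneg)
  ultimately show ?thesis by simp
qed

text \<open>In terms of a measure this says that the integral of \<open>u\<close> over \<open>B - A\<close> is at most
  \<open>\<kappa> * \<mu> (B - A)\<close>. Without a measure one splits a majorant \<open>w\<close> of \<open>1\<close> on \<open>B\<close> by a Urysohn function
  \<open>\<theta>\<close> into a majorant \<open>\<theta> * w\<close> of \<open>1\<close> on \<open>A\<close> and a rest which, multiplied by \<open>\<kappa>\<close>, dominates \<open>u\<close>
  on the part of \<open>B\<close> where a given majorant \<open>v\<close> of \<open>u\<close> on \<open>A\<close> fails to do so.\<close>

lemma upper_integral_diff_le:
  assumes X: "compact (UNIV :: 'a set)" and "closed A" "closed B" "A \<subseteq> B"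
    and u: "continuous_on UNIV u" "\<And>x. 0 \<le> u x" and \<kappa>: "0 \<le> \<kappa>" "\<And>x. x \<in> B - A \<Longrightarrow> u x \<le> \<kappa>"
  shows "upper_integral B u + \<kappa> * upper_integral A (\<lambda>x. 1)
       \<le> upper_integral A u + \<kappa> * upper_integral B (\<lambda>x. 1)"
proof (rule field_le_epsilon)
  fix e :: real assume "0 < e"
  define e' where "e' = e / (1 + \<kappa> + L (\<lambda>x. 1))"
  have L1: "0 \<le> L (\<lambda>x. 1)" by (rule nonneg) auto
  have "0 < e'" using \<open>0 < e\<close> \<kappa> L1 by (simp add: e'_def add_pos_nonneg)
  obtain v where v: "v \<in> majorants A u" "L v < upper_integral A u + e'"
    using upper_integral_approx[OF u \<open>0 < e'\<close>] by blast
  obtain w where w: "w \<in> majorants B (\<lambda>x. 1)" "L w < upper_integral B (\<lambda>x. 1) + e'"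
    using upper_integral_approx[of "\<lambda>x. 1", OF _ _ \<open>0 < e'\<close>] by auto
  have vc: "continuous_on UNIV v" "\<And>x. 0 \<le> v x" "\<And>x. x \<in> A \<Longrightarrow> u x \<le> v x"
    and wc: "continuous_on UNIV w" "\<And>x. 0 \<le> w x" "\<And>x. x \<in> B \<Longrightarrow> 1 \<le> w x"
    using v w by (auto simp: majorants_def)
  define D where "D = {x. v x + e' \<le> u x}"
  have "closed D" unfolding D_def using vc u by (intro closed_Collect_le continuous_intros)
  moreover have "D \<inter> A = {}" using vc(3) \<open>0 < e'\<close> by (force simp: D_def)
  ultimately obtain \<theta> where \<theta>: "continuous_on UNIV \<theta>" "\<And>x. 0 \<le> \<theta> x" "\<And>x. \<theta> x \<le> (1::real)"
      "\<And>x. x \<in> D \<Longrightarrow> \<theta> x = 0" "\<And>x. x \<in> A \<Longrightarrow> \<theta> x = 1"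
    using compact_Urysohn[OF X _ \<open>closed A\<close>] by metis
  let ?r = "\<lambda>x. \<kappa> * ((1 - \<theta> x) * w x)"
  have r: "continuous_on UNIV ?r" "\<And>x. 0 \<le> ?r x"
    using \<theta> wc \<kappa> by (auto intro!: continuous_intros mult_nonneg_nonneg)
  have "(\<lambda>x. (v x + e') + ?r x) \<in> majorants B u"
    unfolding majorants_def
  proof (intro CollectI conjI ballI allI)
    show "continuous_on UNIV (\<lambda>x. v x + e' + ?r x)" using vc \<theta>(1) wc(1) by (intro continuous_intros)
    show "0 \<le> v x + e' + ?r x" for x using r(2)[of x] vc(2)[of x] \<open>0 < e'\<close> by linarith
    fix x assume "x \<in> B"
    show "u x \<le> v x + e' + ?r x"
    proof (cases "x \<in> D")
      case False
      then show ?thesis using r(2)[of x] by (simp add: D_def)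
    next
      case True
      then have "u x \<le> \<kappa>" using \<kappa>(2) \<open>x \<in> B\<close> \<open>D \<inter> A = {}\<close> by blast
      also have "\<kappa> * 1 \<le> \<kappa> * w x" using wc(3)[OF \<open>x \<in> B\<close>] \<kappa> by (intro mult_left_mono)
      finally show ?thesis using \<theta>(4)[OF True] vc(2)[of x] \<open>0 < e'\<close> by simp
    qed
  qed
  from upper_integral_le[OF this]
  have 1: "upper_integral B u \<le> L (\<lambda>x. (v x + e') + ?r x)" .
  also have "\<dots> = L (\<lambda>x. v x + e') + L ?r"
    by (rule add) (use r vc \<theta>(1) wc(1) \<open>0 < e'\<close> in \<open>simp_all add: continuous_on_add del: mult_nonneg_nonneg\<close>)
  also have "L (\<lambda>x. v x + e') = L v + L (\<lambda>x. e')"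
    by (rule add) (use vc \<open>0 < e'\<close> in auto)
  also have "L (\<lambda>x. e') = e' * L (\<lambda>x. 1)" using scale[of "\<lambda>x. 1" e'] \<open>0 < e'\<close> by simp
  also have "L ?r = \<kappa> * L (\<lambda>x. (1 - \<theta> x) * w x)"
    by (rule scale) (use \<theta> wc \<kappa> in \<open>auto intro!: continuous_intros\<close>)
  finally have 1: "upper_integral B u \<le> L v + e' * L (\<lambda>x. 1) + \<kappa> * L (\<lambda>x. (1 - \<theta> x) * w x)" .
  have "(\<lambda>x. \<theta> x * w x) \<in> majorants A (\<lambda>x. 1)"
    unfolding majorants_def using \<theta> wc \<open>A \<subseteq> B\<close> by (auto intro!: continuous_intros)
  from upper_integral_le[OF this] have 2: "upper_integral A (\<lambda>x. 1) \<le> L (\<lambda>x. \<theta> x * w x)" .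
  have "L (\<lambda>x. \<theta> x * w x + (1 - \<theta> x) * w x) = L (\<lambda>x. \<theta> x * w x) + L (\<lambda>x. (1 - \<theta> x) * w x)"
    by (rule add) (use \<theta> wc in \<open>auto intro!: continuous_intros\<close>)
  moreover have "(\<lambda>x. \<theta> x * w x + (1 - \<theta> x) * w x) = w" by (auto simp: algebra_simps)
  ultimately have 3: "L w = L (\<lambda>x. \<theta> x * w x) + L (\<lambda>x. (1 - \<theta> x) * w x)" by simp
  have "upper_integral B u + \<kappa> * upper_integral A (\<lambda>x. 1)
      \<le> L v + e' * L (\<lambda>x. 1) + \<kappa> * L (\<lambda>x. (1 - \<theta> x) * w x) + \<kappa> * L (\<lambda>x. \<theta> x * w x)"
    using 1 mult_left_mono[OF 2 \<kappa>(1)] by linarith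
  also have "\<dots> = L v + e' * L (\<lambda>x. 1) + \<kappa> * L w" by (simp add: 3 distrib_left)
  also have "\<dots> \<le> (upper_integral A u + e') + e' * L (\<lambda>x. 1) + \<kappa> * (upper_integral B (\<lambda>x. 1) + e')"
    using v(2) mult_left_mono[OF less_imp_le[OF w(2)] \<kappa>(1)] by linarith
  also have "\<dots> = upper_integral A u + \<kappa> * upper_integral B (\<lambda>x. 1) + e' * (1 + \<kappa> + L (\<lambda>x. 1))"
    by (simp add: algebra_simps)
  also have "e' * (1 + \<kappa> + L (\<lambda>x. 1)) = e" using \<kappa> L1 by (simp add: e'_def)
  finally show "upper_integral B u + \<kappa> * upper_integral A (\<lambda>x. 1)
      \<le> upper_integral A u + \<kappa> * upper_integral B (\<lambda>x. 1) + e" .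
qed

lemma upper_integral_chain:
  assumes X: "compact (UNIV :: 'a set)" and "\<C> \<noteq> {}" and cl: "\<And>Z. Z \<in> \<C> \<Longrightarrow> closed Z"
    and tot: "\<And>Y Z. Y \<in> \<C> \<Longrightarrow> Z \<in> \<C> \<Longrightarrow> Y \<subseteq> Z \<or> Z \<subseteq> Y" and "0 < e"
  obtains Z where "Z \<in> \<C>" "upper_integral Z (\<lambda>x. 1) < upper_integral (\<Inter>\<C>) (\<lambda>x. 1) + e"
proof -
  have L1: "0 \<le> L (\<lambda>x. 1)" by (rule nonneg) auto
  define d where "d = e / (2 * (1 + L (\<lambda>x. 1)))"
  have "0 < d" using \<open>0 < e\<close> L1 by (simp add: d_def)
  obtain v where v: "v \<in> majorants (\<Inter>\<C>) (\<lambda>x. 1)" "L v < upper_integral (\<Inter>\<C>) (\<lambda>x. 1) + e / 2"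
    using upper_integral_approx[of "\<lambda>x. 1" "e / 2" "\<Inter>\<C>"] \<open>0 < e\<close> by auto
  have vc: "continuous_on UNIV v" "\<And>x. 0 \<le> v x" "\<And>x. x \<in> \<Inter>\<C> \<Longrightarrow> 1 \<le> v x"
    using v by (auto simp: majorants_def)
  have "open {x. 1 - d < v x}" using vc(1) by (intro open_Collect_less continuous_intros)
  moreover have "\<Inter>\<C> \<subseteq> {x. 1 - d < v x}" using vc(3) \<open>0 < d\<close> by force
  ultimately obtain Z where Z: "Z \<in> \<C>" "Z \<subseteq> {x. 1 - d < v x}"
    using chain_Inter_subset_open[OF X \<open>\<C> \<noteq> {}\<close> cl tot] by metis
  have "(\<lambda>x. v x + d) \<in> majorants Z (\<lambda>x. 1)"
    unfolding majorants_def using Z(2) vc \<open>0 < d\<close>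
    by (force intro!: continuous_intros add_nonneg_nonneg)
  from upper_integral_le[OF this] have "upper_integral Z (\<lambda>x. 1) \<le> L (\<lambda>x. v x + d)" .
  also have "\<dots> = L v + L (\<lambda>x. d)" by (rule add) (use vc \<open>0 < d\<close> in auto)
  also have "L (\<lambda>x. d) = d * L (\<lambda>x. 1)" using scale[of "\<lambda>x. 1" d] \<open>0 < d\<close> by simp
  also have "d * L (\<lambda>x. 1) \<le> d * (1 + L (\<lambda>x. 1))" using \<open>0 < d\<close> by simp
  also have "\<dots> = e / 2" using L1 by (simp add: d_def field_simps)
  finally show thesis using v(2) Z(1) by (intro that[of Z]) auto
qed

text \<open>Along a filter, pointwise convergence of bounded functions does not suffice for convergence of
  the integrals. The premise on pieces is a substitute. Suppose that \<open>L (u i)\<close> frequently exceeds some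
  \<open>c > 0\<close>, and fix \<open>\<kappa>\<close> small compared with \<open>c\<close>. Then for \<open>A = UNIV\<close> the integrals of \<open>u i\<close> over \<open>A\<close>
  frequently exceed \<open>\<kappa> * \<mu> A + c / 2 - \<eta>\<close>, whatever \<open>\<eta> > 0\<close> is. This condition on \<open>A\<close> survives
  intersections of chains, so there is a minimal closed set \<open>A\<close> with it. On one of the pieces of \<open>A\<close>
  the functions \<open>u i\<close> that witness the condition are frequently at most \<open>\<kappa>\<close>, and this piece can be
  removed from \<open>A\<close> without violating the condition.\<close>

theorem dominated_convergence:
  fixes u :: "'i \<Rightarrow> 'a \<Rightarrow> real" and F :: "'i filter"
  assumes X: "compact (UNIV :: 'a set)"
    and u: "\<And>i. continuous_on UNIV (u i)" "\<And>i x. 0 \<le> u i x" "\<And>i x. u i x \<le> M"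
    and pieces: "\<And>A \<kappa>. closed A \<Longrightarrow> A \<noteq> {} \<Longrightarrow> 0 < \<kappa> \<Longrightarrow> \<exists>\<V>. finite \<V> \<and>
        (\<forall>V\<in>\<V>. open V \<and> V \<inter> A \<noteq> {}) \<and> (\<forall>\<^sub>F i in F. \<exists>V\<in>\<V>. \<forall>x\<in>V \<inter> A. u i x \<le> \<kappa>)"
  shows "((\<lambda>i. L (u i)) \<longlongrightarrow> 0) F"
proof (rule ccontr)
  assume "\<not> ?thesis"
  then obtain c where "0 < c" and c: "\<not> (\<forall>\<^sub>F i in F. dist (L (u i)) 0 < c)"
    unfolding tendsto_iff by blast
  have freq: "\<exists>\<^sub>F i in F. c \<le> L (u i)"
    using c nonneg[OF u(1,2)] by (simp add: frequently_def not_le dist_norm)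
  let ?m = "\<lambda>A. upper_integral A (\<lambda>x. 1)"
  have L1: "0 \<le> L (\<lambda>x. 1)" by (rule nonneg) auto
  have M: "0 \<le> M" using u(2,3) order_trans by blast
  \<comment> \<open>Chosen such that \<open>\<kappa>\<close> times the total mass is at most \<open>c / 2\<close>.\<close>
  define \<kappa> where "\<kappa> = c / (2 * (1 + L (\<lambda>x. 1)))"
  have \<kappa>: "0 < \<kappa>" using \<open>0 < c\<close> L1 by (simp add: \<kappa>_def)
  have m_UNIV: "?m UNIV = L (\<lambda>x. 1)" by (rule upper_integral_UNIV) auto
  have "\<kappa> * L (\<lambda>x. 1) \<le> \<kappa> * (1 + L (\<lambda>x. 1))" using \<kappa> by simp
  also have "\<dots> = c / 2" using L1 by (simp add: \<kappa>_def field_simps)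
  finally have \<kappa>L: "\<kappa> * ?m UNIV \<le> c / 2" by (simp add: m_UNIV)
  define P where "P A \<longleftrightarrow> (\<forall>\<eta>>0. \<exists>\<^sub>F i in F. \<kappa> * ?m A + c / 2 - \<eta> < upper_integral A (u i))" for A
  have "P UNIV" unfolding P_def
  proof (intro allI impI)
    fix \<eta> :: real assume "0 < \<eta>"
    then show "\<exists>\<^sub>F i in F. \<kappa> * ?m UNIV + c / 2 - \<eta> < upper_integral UNIV (u i)"
      using freq by (elim frequently_elim1) (use \<kappa>L upper_integral_UNIV[OF u(1,2)] in auto)
  qed
  obtain A where A: "closed A" "P A" "\<And>Y. closed Y \<Longrightarrow> Y \<subseteq> A \<Longrightarrow> P Y \<Longrightarrow> Y = A"
  proof (rule minimal_closed_subset[of UNIV P])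
    fix \<C> :: "'a set set"
    assume ne: "\<C> \<noteq> {}" and P: "\<And>Z. Z \<in> \<C> \<Longrightarrow> closed Z \<and> P Z"
      and tot: "\<And>Y Z. Y \<in> \<C> \<Longrightarrow> Z \<in> \<C> \<Longrightarrow> Y \<subseteq> Z \<or> Z \<subseteq> Y"
    show "P (\<Inter>\<C>)" unfolding P_def
    proof (intro allI impI)
      fix \<eta> :: real assume "0 < \<eta>"
      then have "0 < \<eta> / (2 * (1 + M))" using M by simp
      then obtain Z where Z: "Z \<in> \<C>" "?m Z < ?m (\<Inter>\<C>) + \<eta> / (2 * (1 + M))"
        using upper_integral_chain[OF X ne _ tot, of "\<eta> / (2 * (1 + M))"] P by metis
      have "M * (?m Z - ?m (\<Inter>\<C>)) \<le> M * (\<eta> / (2 * (1 + M)))"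
        using Z(2) M by (intro mult_left_mono) auto
      also have "\<dots> \<le> (1 + M) * (\<eta> / (2 * (1 + M)))"
        using M \<open>0 < \<eta>\<close> by (intro mult_right_mono) auto
      also have "\<dots> = \<eta> / 2" using M by (simp add: field_simps)
      finally have small: "M * (?m Z - ?m (\<Inter>\<C>)) \<le> \<eta> / 2" .
      have "?m (\<Inter>\<C>) \<le> ?m Z" using Z(1) by (intro upper_integral_mono_set) auto
      then have le: "\<kappa> * ?m (\<Inter>\<C>) \<le> \<kappa> * ?m Z" using \<kappa> by simp
      have "\<exists>\<^sub>F i in F. \<kappa> * ?m Z + c / 2 - \<eta> / 2 < upper_integral Z (u i)"
        using P[OF Z(1)] \<open>0 < \<eta>\<close> unfolding P_def by (meson half_gt_zero)
      then show "\<exists>\<^sub>F i in F. \<kappa> * ?m (\<Inter>\<C>) + c / 2 - \<eta> < upper_integral (\<Inter>\<C>) (u i)"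
      proof (rule frequently_elim1)
        fix i assume i: "\<kappa> * ?m Z + c / 2 - \<eta> / 2 < upper_integral Z (u i)"
        have "upper_integral Z (u i) + M * ?m (\<Inter>\<C>) \<le> upper_integral (\<Inter>\<C>) (u i) + M * ?m Z"
          using P Z(1) u M by (intro upper_integral_diff_le X) auto
        then show "\<kappa> * ?m (\<Inter>\<C>) + c / 2 - \<eta> < upper_integral (\<Inter>\<C>) (u i)"
          using i small le by (simp add: right_diff_distrib)
      qed
    qed
  qed (use \<open>P UNIV\<close> in auto)
  have "A \<noteq> {}"
  proof
    assume "A = {}"
    with A(2) have "\<exists>\<^sub>F i in F. \<kappa> * ?m {} + c / 2 - c / 2 < upper_integral {} (u i)"
      unfolding P_def using \<open>0 < c\<close> by (meson half_gt_zero)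
    then show False by (simp add: upper_integral_empty)
  qed
  then obtain \<V> where V: "finite \<V>" "\<And>V. V \<in> \<V> \<Longrightarrow> open V \<and> V \<inter> A \<noteq> {}"
    "\<forall>\<^sub>F i in F. \<exists>V\<in>\<V>. \<forall>x\<in>V \<inter> A. u i x \<le> \<kappa>"
    using pieces[OF A(1) _ \<kappa>] by blast
  have "\<exists>V\<in>\<V>. P (A - V)"
  proof (rule ccontr)
    assume "\<not> ?thesis"
    then have "\<forall>V\<in>\<V>. \<exists>\<eta>>0. \<forall>\<^sub>F i in F. upper_integral (A - V) (u i) \<le> \<kappa> * ?m (A - V) + c / 2 - \<eta>"
      by (simp add: P_def not_frequently not_less)
    then obtain \<eta> where \<eta>: "\<And>V. V \<in> \<V> \<Longrightarrow> 0 < \<eta> V"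
      "\<And>V. V \<in> \<V> \<Longrightarrow> \<forall>\<^sub>F i in F. upper_integral (A - V) (u i) \<le> \<kappa> * ?m (A - V) + c / 2 - \<eta> V"
      by metis
    obtain \<epsilon> where \<epsilon>: "0 < \<epsilon>" "\<And>V. V \<in> \<V> \<Longrightarrow> \<epsilon> \<le> \<eta> V"
    proof
      show "0 < Min (insert 1 (\<eta> ` \<V>))" using V(1) \<eta>(1) by (subst Min_gr_iff) auto
      show "Min (insert 1 (\<eta> ` \<V>)) \<le> \<eta> V" if "V \<in> \<V>" for V using V(1) that by auto
    qed
    have "\<forall>\<^sub>F i in F. \<forall>V\<in>\<V>. upper_integral (A - V) (u i) \<le> \<kappa> * ?m (A - V) + c / 2 - \<eta> V"
      using V(1) \<eta>(2) by (simp add: eventually_ball_finite)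
    with V(3) have "\<forall>\<^sub>F i in F. upper_integral A (u i) \<le> \<kappa> * ?m A + c / 2 - \<epsilon>"
    proof eventually_elim
      case (elim i)
      then obtain W where W: "W \<in> \<V>" "\<forall>x\<in>W \<inter> A. u i x \<le> \<kappa>" by blast
      have "upper_integral A (u i) + \<kappa> * ?m (A - W) \<le> upper_integral (A - W) (u i) + \<kappa> * ?m A"
        using V(2)[OF W(1)] W(2) A(1) u \<kappa> by (intro upper_integral_diff_le X) auto
      then show ?case using elim(2) W(1) \<epsilon>(2) by fastforce
    qed
    then show False using A(2) \<epsilon>(1) unfolding P_def by (auto simp: frequently_def not_less)
  qed
  then obtain V where "V \<in> \<V>" "P (A - V)" by blast
  then have "A - V = A" using A V(2) by (intro A(3)) auto
  then show False using V(2)[OF \<open>V \<in> \<V>\<close>] by blast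
qed

end


section \<open>Tameness and small oscillation\<close>

lemma compact_chain_nonempty_Inter:
  fixes K :: "nat \<Rightarrow> 'a::topological_space set"
  assumes "compact (UNIV :: 'a set)" "\<And>n. closed (K n)" "\<And>n. K n \<noteq> {}" "\<And>n. K (Suc n) \<subseteq> K n"
  shows "(\<Inter>n. K n) \<noteq> {}"
proof -
  have dec: "K n \<subseteq> K m" if "m \<le> n" for m n using that by (rule lift_Suc_antimono_le[of K, OF assms(4)])
  have "UNIV \<inter> (\<Inter>n\<in>UNIV. K n) \<noteq> {}"
  proof (rule compact_imp_fip_image[OF assms(1)])
    fix I :: "nat set" assume I: "finite I"
    have "K (Max (insert 0 I)) \<subseteq> (\<Inter>n\<in>I. K n)"
      using dec I by (meson INT_greatest Max_ge finite_insert insertI2)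
    then show "UNIV \<inter> (\<Inter>n\<in>I. K n) \<noteq> {}" using assms(3) by auto
  qed (use assms in auto)
  then show ?thesis by simp
qed

text \<open>The filter \<open>F\<close> plays the part of a subnet along which the translations converge.\<close>

lemma tame_cluster_point:
  fixes act :: "'s::semitopological_monoid \<Rightarrow> 'x::t2_space \<Rightarrow> 'x" and s :: "nat \<Rightarrow> 's"
  assumes sys: "compact_system euclidean act" and tame: "tame euclidean act"
  obtains p F where "F \<noteq> bot" "F \<le> sequentially" "\<And>x. ((\<lambda>n. act (s n) x) \<longlongrightarrow> p x) F"
    "fragmented_map euclidean (entourages euclidean) p"
proof -
  have "compact_space (product_topology (\<lambda>_. euclidean :: 'x topology) UNIV)"
    using sys by (simp add: compact_system_def compact_space_product_topology)
  then have "compact (UNIV :: ('x \<Rightarrow> 'x) set)"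
    by (simp add: euclidean_product_topology compact_space_def)
  then obtain p where p: "inf (nhds p) (filtermap (\<lambda>n. act (s n)) sequentially) \<noteq> bot"
    unfolding compact_filter
    by (metis UNIV_I always_eventually filtermap_bot_iff trivial_limit_sequentially)
  define F where "F = inf sequentially (filtercomap (\<lambda>n. act (s n)) (nhds p))"
  have freq: "\<exists>\<^sub>F n in sequentially. Q (act (s n))" if "eventually Q (nhds p)" for Q
  proof (rule ccontr)
    assume "\<not> ?thesis"
    then have "eventually (\<lambda>g. \<not> Q g) (filtermap (\<lambda>n. act (s n)) sequentially)"
      by (simp add: eventually_filtermap frequently_def)
    with that have "eventually (\<lambda>g. False) (inf (nhds p) (filtermap (\<lambda>n. act (s n)) sequentially))"
      unfolding eventually_inf by blast
    with p show False by (simp add: trivial_limit_def)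
  qed
  have "F \<noteq> bot"
  proof
    assume "F = bot"
    then have "eventually (\<lambda>n. False) F" by simp
    then obtain P R where "eventually P sequentially" "eventually R (nhds p)"
      "\<And>n. P n \<Longrightarrow> R (act (s n)) \<Longrightarrow> False"
      unfolding F_def eventually_inf eventually_filtercomap by blast
    then show False using frequently_ex[OF frequently_eventually_conj[OF freq]] by blast
  qed
  have lim: "((\<lambda>n. act (s n)) \<longlongrightarrow> p) F"
    unfolding F_def by (meson filterlim_filtercomap filterlim_mono inf_le2 order_refl)
  have "continuous_on UNIV (\<lambda>g :: 'x \<Rightarrow> 'x. g x)" for x by (rule continuous_on_product_coordinates)
  from continuous_on_tendsto_compose[OF this lim]
  have "((\<lambda>n. act (s n) x) \<longlongrightarrow> p x) F" for x by simp
  moreover have "p \<in> enveloping_semigroup euclidean act"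
    unfolding enveloping_semigroup_def
  proof -
    have "p \<in> closure (range act)"
    proof (rule Lim_in_closed_set[OF closed_closure _ \<open>F \<noteq> bot\<close> lim])
      show "\<forall>\<^sub>F n in F. act (s n) \<in> closure (range act)"
        by (intro always_eventually allI closure_subset[THEN subsetD] rangeI)
    qed
    then show "p \<in> product_topology (\<lambda>_. euclidean) (topspace euclidean) closure_of
        range (\<lambda>s. restrict (act s) (topspace euclidean))"
      by (simp add: euclidean_product_topology restrict_def)
  qed
  ultimately show thesis using that[of F p] \<open>F \<noteq> bot\<close> tame by (simp add: F_def tame_def)
qed

text \<open>Tameness excludes independent sequences among the translates of a continuous function: the
  sets that are intersected with \<open>A\<close> are the cells of the Boolean patterns of such a sequence. If all cells
  met \<open>A\<close>, take a minimal closed \<open>Z\<close> that meets all of them and a cluster point \<open>p\<close> of the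
  translations. By fragmentability \<open>f \<circ> p\<close> oscillates by less than \<open>\<delta>\<close> on \<open>V \<inter> Z\<close> for some open
  \<open>V\<close>, and by minimality some cell of \<open>Z\<close> lies in \<open>V\<close>. But a cell contains points whose patterns
  continue with the constant low value and points whose patterns continue with the constant high
  value.\<close>

lemma tame_no_independent_sequence:
  fixes act :: "'s::semitopological_monoid \<Rightarrow> 'x::t2_space \<Rightarrow> 'x" and f :: "'x \<Rightarrow> real"
    and s :: "nat \<Rightarrow> 's"
  assumes sys: "compact_system euclidean act" and tame: "tame euclidean act"
    and f: "continuous_on UNIV f" and "0 < \<delta>" and "closed A"
  shows "\<exists>b n. A \<inter> {x. \<forall>k<n. if b k then r + \<delta> \<le> f (act (s k) x) else f (act (s k) x) \<le> r} = {}"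
proof (rule ccontr)
  define K where "K b n = {x. \<forall>k<n. if b k then r + \<delta> \<le> f (act (s k) x) else f (act (s k) x) \<le> r}"
    for b :: "nat \<Rightarrow> bool" and n
  assume "\<not> ?thesis"
  then have ne: "\<And>b n. A \<inter> K b n \<noteq> {}" unfolding K_def by blast
  have X: "compact (UNIV :: 'x set)" using sys by (simp add: compact_system_def compact_space_def)
  have act: "continuous_on UNIV (act t)" for t using sys by (simp add: compact_system_def)
  have fact: "continuous_on UNIV (\<lambda>x. f (act t x))" for t
    by (rule continuous_on_compose2[OF f act]) auto
  have cl: "closed (K b n)" for b n
  proof -
    have "K b n = (\<Inter>k\<in>{..<n}. if b k then {x. r + \<delta> \<le> f (act (s k) x)} else {x. f (act (s k) x) \<le> r})"
      by (auto simp: K_def split: if_splits)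
    also have "closed \<dots>" by (auto intro!: closed_INT closed_Collect_le fact continuous_on_const)
    finally show ?thesis .
  qed
  have K_Suc: "K b (Suc n) \<subseteq> K b n" for b n by (auto simp: K_def)
  have K_cong: "K b n = K b' n" if "\<And>k. k < n \<Longrightarrow> b k = b' k" for b b' n using that by (auto simp: K_def)
  obtain Z where Z: "closed Z" "Z \<subseteq> A" "\<And>b n. Z \<inter> K b n \<noteq> {}"
    "\<And>Y. closed Y \<Longrightarrow> Y \<subseteq> Z \<Longrightarrow> (\<forall>b n. Y \<inter> K b n \<noteq> {}) \<Longrightarrow> Y = Z"
  proof (rule minimal_closed_subset[of A "\<lambda>Z. \<forall>b n. Z \<inter> K b n \<noteq> {}"])
    fix \<C> :: "'x set set"
    assume C: "\<C> \<noteq> {}" "\<And>Z. Z \<in> \<C> \<Longrightarrow> closed Z \<and> (\<forall>b n. Z \<inter> K b n \<noteq> {})"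
      "\<And>Y Z. Y \<in> \<C> \<Longrightarrow> Z \<in> \<C> \<Longrightarrow> Y \<subseteq> Z \<or> Z \<subseteq> Y"
    show "\<forall>b n. \<Inter>\<C> \<inter> K b n \<noteq> {}"
    proof (intro allI notI)
      fix b n assume "\<Inter>\<C> \<inter> K b n = {}"
      then have "\<Inter>\<C> \<subseteq> - K b n" by blast
      with chain_Inter_subset_open[OF X C(1) _ C(3), of "- K b n"] cl C(2)
      obtain Z where "Z \<in> \<C>" "Z \<subseteq> - K b n" by (metis open_Compl)
      then show False using C(2)[of Z] by blast
    qed
  qed (use \<open>closed A\<close> ne in auto)
  obtain p F where p: "F \<noteq> bot" "F \<le> sequentially" "\<And>x. ((\<lambda>n. act (s n) x) \<longlongrightarrow> p x) F"
    "fragmented_map euclidean (entourages euclidean) p"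
    using tame_cluster_point[OF sys tame, of s] by metis
  have lim: "((\<lambda>n. f (act (s n) x)) \<longlongrightarrow> f (p x)) F" for x
    using continuous_on_tendsto_compose[OF f p(3)] by simp
  define W where "W = {(y, z). \<bar>f y - f z\<bar> < \<delta>}"
  have "open W" unfolding W_def case_prod_beta
    by (intro open_Collect_less continuous_intros continuous_on_compose2[OF f]) auto
  then have "W \<in> entourages euclidean"
    using \<open>0 < \<delta>\<close> by (auto simp: entourages_def euclidean_product_topology W_def intro!: exI[of _ W])
  moreover have "Z \<noteq> {}" using Z(3) by blast
  ultimately obtain V where V: "open V" "V \<inter> Z \<noteq> {}" "p ` (V \<inter> Z) \<times> p ` (V \<inter> Z) \<subseteq> W"
    using p(4) unfolding fragmented_map_def by (metis open_openin subset_UNIV topspace_euclidean)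
  have "Z - V \<noteq> Z" using V(2) by blast
  then obtain b n where bn: "(Z - V) \<inter> K b n = {}"
    using Z(4)[of "Z - V"] Z(1) V(1) by blast
  \<comment> \<open>Points of the cell \<open>(b, n)\<close> whose patterns are eventually constant.\<close>
  have "\<exists>x \<in> V \<inter> Z. \<forall>k\<ge>n. if c then r + \<delta> \<le> f (act (s k) x) else f (act (s k) x) \<le> r" for c
  proof -
    define b' where "b' k = (if k < n then b k else c)" for k
    have "(\<Inter>m. Z \<inter> K b' m) \<noteq> {}"
    proof (rule compact_chain_nonempty_Inter[OF X])
      show "Z \<inter> K b' (Suc m) \<subseteq> Z \<inter> K b' m" for m using K_Suc by blast
    qed (use Z(1,3) cl in auto)
    then obtain x where x: "x \<in> Z" "\<And>m. x \<in> K b' m" by blast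
    have "x \<in> K b n" using x(2)[of n] K_cong[of n b b'] by (simp add: b'_def)
    then have "x \<in> V \<inter> Z" using bn x(1) by blast
    moreover have "if c then r + \<delta> \<le> f (act (s k) x) else f (act (s k) x) \<le> r" if "n \<le> k" for k
      using x(2)[of "Suc k"] that unfolding K_def b'_def by (auto dest!: spec[of _ k] split: if_splits)
    ultimately show ?thesis by blast
  qed
  from this[of False] this[of True]
  obtain x y where x: "x \<in> V \<inter> Z" "\<And>k. n \<le> k \<Longrightarrow> f (act (s k) x) \<le> r"
    and y: "y \<in> V \<inter> Z" "\<And>k. n \<le> k \<Longrightarrow> r + \<delta> \<le> f (act (s k) y)" by auto
  have ev: "\<forall>\<^sub>F k in F. n \<le> k" using p(2) eventually_ge_at_top by (metis filter_leD)
  have "f (p x) \<le> r"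
    by (rule tendsto_upperbound[OF lim _ p(1)]) (use ev x(2) in \<open>auto elim: eventually_mono\<close>)
  moreover have "r + \<delta> \<le> f (p y)"
    by (rule tendsto_lowerbound[OF lim _ p(1)]) (use ev y(2) in \<open>auto elim: eventually_mono\<close>)
  moreover have "(p x, p y) \<in> W" using V(3) x(1) y(1) by blast
  ultimately show False by (auto simp: W_def)
qed

text \<open>Up to finitely many alternatives, the property \<open>P i\<close> holds on a nonempty open piece of every
  nonempty open piece of \<open>A\<close>, where the alternatives do not depend on \<open>i\<close>. Quantifying over the ambient
  piece makes the notion closed under conjunction.\<close>

definition finitely_locally :: "'a::topological_space set \<Rightarrow> ('i \<Rightarrow> 'a set \<Rightarrow> bool) \<Rightarrow> bool" where
  "finitely_locally A P \<longleftrightarrow> (\<forall>U. open U \<and> U \<inter> A \<noteq> {} \<longrightarrow>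
     (\<exists>\<V>. finite \<V> \<and> (\<forall>V\<in>\<V>. open V \<and> V \<subseteq> U \<and> V \<inter> A \<noteq> {}) \<and> (\<forall>i. \<exists>V\<in>\<V>. P i (V \<inter> A))))"

lemma finitely_locally_conj:
  assumes P: "finitely_locally A P" and Q: "finitely_locally A Q"
    and anti: "\<And>i B C. P i B \<Longrightarrow> C \<subseteq> B \<Longrightarrow> P i C"
  shows "finitely_locally A (\<lambda>i B. P i B \<and> Q i B)"
  unfolding finitely_locally_def
proof (intro allI impI)
  fix U assume U: "open U \<and> U \<inter> A \<noteq> {}"
  obtain \<V> where V: "finite \<V>" "\<And>V. V \<in> \<V> \<Longrightarrow> open V \<and> V \<subseteq> U \<and> V \<inter> A \<noteq> {}"
    "\<And>i. \<exists>V\<in>\<V>. P i (V \<inter> A)"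
    using P[unfolded finitely_locally_def, rule_format, OF U] by auto
  have "\<forall>V\<in>\<V>. \<exists>\<W>. finite \<W> \<and> (\<forall>W\<in>\<W>. open W \<and> W \<subseteq> V \<and> W \<inter> A \<noteq> {}) \<and> (\<forall>i. \<exists>W\<in>\<W>. Q i (W \<inter> A))"
    using Q V(2) unfolding finitely_locally_def by presburger
  then obtain \<W> where W: "\<And>V. V \<in> \<V> \<Longrightarrow> finite (\<W> V)"
    "\<And>V W. V \<in> \<V> \<Longrightarrow> W \<in> \<W> V \<Longrightarrow> open W \<and> W \<subseteq> V \<and> W \<inter> A \<noteq> {}"
    "\<And>V i. V \<in> \<V> \<Longrightarrow> \<exists>W\<in>\<W> V. Q i (W \<inter> A)" by metis
  show "\<exists>\<V>. finite \<V> \<and> (\<forall>V\<in>\<V>. open V \<and> V \<subseteq> U \<and> V \<inter> A \<noteq> {}) \<and>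
      (\<forall>i. \<exists>V\<in>\<V>. P i (V \<inter> A) \<and> Q i (V \<inter> A))"
  proof (intro exI conjI)
    show "\<forall>i. \<exists>V\<in>\<Union>(\<W> ` \<V>). P i (V \<inter> A) \<and> Q i (V \<inter> A)"
    proof
      fix i
      obtain V where "V \<in> \<V>" "P i (V \<inter> A)" using V(3) by blast
      moreover then obtain W where "W \<in> \<W> V" "Q i (W \<inter> A)" using W(3) by blast
      ultimately show "\<exists>V\<in>\<Union>(\<W> ` \<V>). P i (V \<inter> A) \<and> Q i (V \<inter> A)"
        using anti[of i "V \<inter> A" "W \<inter> A"] W(2)[of V W] by blast
    qed
    show "\<forall>W\<in>\<Union>(\<W> ` \<V>). open W \<and> W \<subseteq> U \<and> W \<inter> A \<noteq> {}" using V(2) W(2) by blast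
  qed (use V(1) W(1) in auto)
qed

lemma finitely_locally_ball:
  assumes "finite J" "\<And>j. j \<in> J \<Longrightarrow> finitely_locally A (P j)"
    and anti: "\<And>j i B C. P j i B \<Longrightarrow> C \<subseteq> B \<Longrightarrow> P j i C"
  shows "finitely_locally A (\<lambda>i B. \<forall>j\<in>J. P j i B)"
  using assms(1,2)
proof (induction J rule: finite_induct)
  case empty
  show ?case by (auto simp: finitely_locally_def intro: exI[of _ "{_}"])
next
  case (insert j J)
  have "finitely_locally A (\<lambda>i B. P j i B \<and> (\<forall>j\<in>J. P j i B))"
    by (rule finitely_locally_conj) (use insert anti in auto)
  then show ?case by simp
qed

lemma finitely_locally_mono:
  "finitely_locally A P \<Longrightarrow> (\<And>i B. P (h i) B \<Longrightarrow> Q i B) \<Longrightarrow> finitely_locally A Q"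
  unfolding finitely_locally_def by meson

text \<open>If no finite family of pieces sufficed, translates could be chosen one after the other so
  that each of them crosses the gap from \<open>r\<close> to \<open>r + \<delta>\<close> on all cells of the previous ones.\<close>

lemma tame_no_crossing:
  fixes act :: "'s::semitopological_monoid \<Rightarrow> 'x::t2_space \<Rightarrow> 'x" and f :: "'x \<Rightarrow> real"
  assumes sys: "compact_system euclidean act" and tame: "tame euclidean act"
    and f: "continuous_on UNIV f" and "0 < \<delta>" and "closed A"
  shows "finitely_locally A (\<lambda>s B. \<not> (\<exists>x\<in>B. \<exists>y\<in>B. f (act s x) < r \<and> r + \<delta> < f (act s y)))"
proof (rule ccontr)
  assume not_loc: "\<not> ?thesis"
  let ?cr = "\<lambda>s B. \<exists>x\<in>B. \<exists>y\<in>B. f (act s x) < r \<and> r + \<delta> < f (act s y)"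
  let ?no = "\<lambda>U. \<not> (\<exists>\<V>. finite \<V> \<and>
      (\<forall>V\<in>\<V>. open V \<and> V \<subseteq> U \<and> V \<inter> A \<noteq> {}) \<and> (\<forall>s. \<exists>V\<in>\<V>. \<not> ?cr s (V \<inter> A)))"
  have "\<exists>U. (open U \<and> U \<inter> A \<noteq> {}) \<and> ?no U"
    using not_loc unfolding finitely_locally_def not_all not_imp .
  then obtain U where U: "open U" "U \<inter> A \<noteq> {}" and no: "?no U" by (elim exE conjE)
  have cross: "\<exists>s. \<forall>V\<in>\<V>. ?cr s (V \<inter> A)"
    if "finite \<V>" "\<forall>V\<in>\<V>. open V \<and> V \<subseteq> U \<and> V \<inter> A \<noteq> {}" for \<V>
  proof (rule ccontr)
    assume "\<not> ?thesis"
    then have "\<forall>s. \<exists>V\<in>\<V>. \<not> ?cr s (V \<inter> A)" by blast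
    with that no show False by blast
  qed
  define good where "good \<V> \<longleftrightarrow> finite \<V> \<and> (\<forall>V\<in>\<V>. open V \<and> V \<subseteq> U \<and> V \<inter> A \<noteq> {})" for \<V>
  obtain \<sigma> where \<sigma>: "\<And>\<V> V. good \<V> \<Longrightarrow> V \<in> \<V> \<Longrightarrow>
      \<exists>x\<in>V \<inter> A. \<exists>y\<in>V \<inter> A. f (act (\<sigma> \<V>) x) < r \<and> r + \<delta> < f (act (\<sigma> \<V>) y)"
    using cross unfolding good_def by metis
  define half where "half c s = (if c then {x. r + \<delta> < f (act s x)} else {x. f (act s x) < r})" for c s
  have act: "continuous_on UNIV (act t)" for t using sys by (simp add: compact_system_def)
  have op: "open (half c s)" for c s
    by (auto simp: half_def intro!: open_Collect_less continuous_on_compose2[OF f act] continuous_on_const)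
  define refine where "refine \<V> = (\<lambda>(c, V). V \<inter> half c (\<sigma> \<V>)) ` (UNIV \<times> \<V>)" for \<V>
  define fam where "fam n = (refine ^^ n) {U}" for n
  have fam: "fam 0 = {U}" "fam (Suc n) = refine (fam n)" for n by (simp_all add: fam_def)
  have good: "good (fam n)" for n
  proof (induction n)
    case 0
    then show ?case using U by (simp add: fam good_def)
  next
    case (Suc n)
    have "V \<inter> half c (\<sigma> (fam n)) \<inter> A \<noteq> {}" if "V \<in> fam n" for V c
      using \<sigma>[OF Suc that] by (cases c) (auto simp: half_def)
    then show ?case using Suc op by (auto simp: good_def fam refine_def)
  qed
  define s where "s n = \<sigma> (fam n)" for n
  have cell: "U \<inter> (\<Inter>k\<in>{..<n}. half (b k) (s k)) \<in> fam n" for b n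
  proof (induction n)
    case (Suc n)
    have "U \<inter> (\<Inter>k\<in>{..<Suc n}. half (b k) (s k)) = (U \<inter> (\<Inter>k\<in>{..<n}. half (b k) (s k))) \<inter> half (b n) (s n)"
      by (auto simp: lessThan_Suc)
    then show ?case using Suc by (force simp: fam refine_def s_def)
  qed (simp add: fam)
  obtain b n where "A \<inter> {x. \<forall>k<n. if b k then r + \<delta> \<le> f (act (s k) x) else f (act (s k) x) \<le> r} = {}"
    using tame_no_independent_sequence[OF assms] by blast
  moreover have "U \<inter> (\<Inter>k\<in>{..<n}. half (b k) (s k)) \<inter> A \<noteq> {}"
    using good[of n] cell[of b n] by (auto simp: good_def)
  then obtain x where "x \<in> A" "\<And>k. k < n \<Longrightarrow> x \<in> half (b k) (s k)" by auto
  then have "x \<in> A \<inter> {x. \<forall>k<n. if b k then r + \<delta> \<le> f (act (s k) x) else f (act (s k) x) \<le> r}"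
    by (fastforce simp: half_def split: if_splits)
  ultimately show False by blast
qed

text \<open>This is the Bourgain property of the translates of \<open>f\<close>. A function that crosses none of finitely
  many suitable gaps has small oscillation, and \<open>finitely_locally\<close> permits treating the gaps one by
  one.\<close>

lemma tame_small_oscillation:
  fixes act :: "'s::semitopological_monoid \<Rightarrow> 'x::t2_space \<Rightarrow> 'x" and f :: "'x \<Rightarrow> real"
  assumes sys: "compact_system euclidean act" and tame: "tame euclidean act"
    and f: "continuous_on UNIV f" and "0 < \<delta>" and "closed A"
  shows "finitely_locally A (\<lambda>s B. \<forall>x\<in>B. \<forall>y\<in>B. \<bar>f (act s x) - f (act s y)\<bar> \<le> 2 * \<delta>)"
proof -
  have "compact (UNIV :: 'x set)" using sys by (simp add: compact_system_def compact_space_def)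
  then obtain M where M: "\<And>x. \<bar>f x\<bar> \<le> M" using compact_bounded[OF _ f] by blast
  \<comment> \<open>An oscillation above \<open>2 * \<delta>\<close> crosses one of the gaps that start at the points of a grid.\<close>
  define N where "N = nat \<lceil>2 * M / \<delta>\<rceil> + 1"
  define r where "r k = - M + real k * \<delta>" for k
  have "finitely_locally A (\<lambda>s B. \<forall>k\<in>{..N}. \<not> (\<exists>x\<in>B. \<exists>y\<in>B. f (act s x) < r k \<and> r k + \<delta> < f (act s y)))"
    by (rule finitely_locally_ball) (use tame_no_crossing[OF assms] in auto)
  then show ?thesis
  proof (rule finitely_locally_mono[where h = id])
    fix s B
    assume nc: "\<forall>k\<in>{..N}. \<not> (\<exists>x\<in>B. \<exists>y\<in>B. f (act (id s) x) < r k \<and> r k + \<delta> < f (act (id s) y))"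
    have "f (act s y) - f (act s x) \<le> 2 * \<delta>" if "x \<in> B" "y \<in> B" for x y
    proof (rule ccontr)
      assume gt: "\<not> ?thesis"
      define k where "k = nat \<lfloor>(f (act s x) + M) / \<delta>\<rfloor> + 1"
      have pos: "0 \<le> (f (act s x) + M) / \<delta>" using M[of "act s x"] \<open>0 < \<delta>\<close> by (simp add: abs_le_iff)
      have "(f (act s x) + M) / \<delta> < real k" "real k \<le> (f (act s x) + M) / \<delta> + 1"
        using pos by (simp_all add: k_def) linarith+
      then have "f (act s x) + M < real k * \<delta>" "real k * \<delta> \<le> f (act s x) + M + \<delta>"
        using \<open>0 < \<delta>\<close> by (simp_all add: field_simps)
      then have 1: "f (act s x) < r k" "r k + \<delta> < f (act s y)" using gt by (simp_all add: r_def)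
      have "(f (act s x) + M) / \<delta> \<le> 2 * M / \<delta>"
        using M[of "act s x"] \<open>0 < \<delta>\<close> by (intro divide_right_mono) auto
      then have "k \<le> N" unfolding k_def N_def by linarith
      then show False using nc 1 that by auto
    qed
    then show "\<forall>x\<in>B. \<forall>y\<in>B. \<bar>f (act s x) - f (act s y)\<bar> \<le> 2 * \<delta>" by (auto simp: abs_le_iff)
  qed
qed

text \<open>The analytic core: although the functions \<open>f \<circ> act s\<close> converge only along filters, tameness
  lets one integrate pointwise limits. Differences of translates are used because the limits
  themselves need not be continuous.\<close>

theorem tame_dominated_convergence:
  fixes act :: "'s::semitopological_monoid \<Rightarrow> 'x::t2_space \<Rightarrow> 'x" and f :: "'x \<Rightarrow> real"
    and a b :: "'i \<Rightarrow> 's"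
  assumes sys: "compact_system euclidean act" and tame: "tame euclidean act"
    and f: "continuous_on UNIV f" and L: "cone_functional L"
    and lim: "\<And>x. ((\<lambda>i. f (act (a i) x) - f (act (b i) x)) \<longlongrightarrow> 0) F"
  shows "((\<lambda>i. L (\<lambda>x. \<bar>f (act (a i) x) - f (act (b i) x)\<bar>)) \<longlongrightarrow> 0) F"
proof -
  have X: "compact (UNIV :: 'x set)" using sys by (simp add: compact_system_def compact_space_def)
  have act: "continuous_on UNIV (act t)" for t using sys by (simp add: compact_system_def)
  have fact: "continuous_on UNIV (\<lambda>x. f (act t x))" for t
    by (rule continuous_on_compose2[OF f act]) auto
  obtain M where M: "\<And>x. \<bar>f x\<bar> \<le> M" using compact_bounded[OF X f] by blast
  let ?osc = "\<lambda>(\<kappa>::real) s B. \<forall>x\<in>B. \<forall>y\<in>B. \<bar>f (act s x) - f (act s y)\<bar> \<le> \<kappa>"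
  show ?thesis
  proof (rule cone_functional.dominated_convergence[OF L X, where M = "2 * M"])
    show "\<bar>f (act (a i) x) - f (act (b i) x)\<bar> \<le> 2 * M" for i x
      using M[of "act (a i) x"] M[of "act (b i) x"] by linarith
  next
    fix A :: "'x set" and \<kappa> :: real assume A: "closed A" "A \<noteq> {}" and "0 < \<kappa>"
    have "finitely_locally A (?osc (\<kappa> / 3))"
      using tame_small_oscillation[OF sys tame f _ A(1), of "\<kappa> / 6"] \<open>0 < \<kappa>\<close> by simp
    then have loc: "finitely_locally A (\<lambda>i. ?osc (\<kappa> / 3) (h i))" for h :: "'i \<Rightarrow> 's"
      by (rule finitely_locally_mono)
    have "finitely_locally A (\<lambda>i B. ?osc (\<kappa> / 3) (a i) B \<and> ?osc (\<kappa> / 3) (b i) B)"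
      by (rule finitely_locally_conj[OF loc loc]) blast
    then obtain \<V> where V: "finite \<V>" "\<And>V. V \<in> \<V> \<Longrightarrow> open V \<and> V \<inter> A \<noteq> {}"
      "\<And>i. \<exists>V\<in>\<V>. ?osc (\<kappa> / 3) (a i) (V \<inter> A) \<and> ?osc (\<kappa> / 3) (b i) (V \<inter> A)"
      using A(2) unfolding finitely_locally_def by (metis (no_types, lifting) Int_UNIV_left open_UNIV)
    define z where "z V = (SOME x. x \<in> V \<inter> A)" for V
    have z: "z V \<in> V \<inter> A" if "V \<in> \<V>" for V using V(2)[OF that] unfolding z_def some_in_eq by blast
    have "\<forall>\<^sub>F i in F. \<bar>f (act (a i) (z V)) - f (act (b i) (z V))\<bar> < \<kappa> / 3" for V
      using tendstoD[OF lim, of "\<kappa> / 3" "z V"] \<open>0 < \<kappa>\<close> by (simp add: dist_norm)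
    then have "\<forall>\<^sub>F i in F. \<forall>V\<in>\<V>. \<bar>f (act (a i) (z V)) - f (act (b i) (z V))\<bar> < \<kappa> / 3"
      using V(1) by (simp add: eventually_ball_finite)
    then have "\<forall>\<^sub>F i in F. \<exists>V\<in>\<V>. \<forall>x\<in>V \<inter> A. \<bar>f (act (a i) x) - f (act (b i) x)\<bar> \<le> \<kappa>"
    proof (rule eventually_mono)
      fix i assume i: "\<forall>V\<in>\<V>. \<bar>f (act (a i) (z V)) - f (act (b i) (z V))\<bar> < \<kappa> / 3"
      obtain V where W: "V \<in> \<V>" "?osc (\<kappa> / 3) (a i) (V \<inter> A)" "?osc (\<kappa> / 3) (b i) (V \<inter> A)"
        using V(3) by blast
      have "\<bar>f (act (a i) x) - f (act (b i) x)\<bar> \<le> \<kappa>" if "x \<in> V \<inter> A" for x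
      proof -
        have "\<bar>f (act (a i) x) - f (act (a i) (z V))\<bar> \<le> \<kappa> / 3" "\<bar>f (act (b i) x) - f (act (b i) (z V))\<bar> \<le> \<kappa> / 3"
          using W that z by blast+
        moreover have "\<bar>f (act (a i) (z V)) - f (act (b i) (z V))\<bar> < \<kappa> / 3" using i W(1) by blast
        ultimately show ?thesis by linarith
      qed
      then show "\<exists>V\<in>\<V>. \<forall>x\<in>V \<inter> A. \<bar>f (act (a i) x) - f (act (b i) x)\<bar> \<le> \<kappa>" using W(1) by blast
    qed
    then show "\<exists>\<V>. finite \<V> \<and> (\<forall>V\<in>\<V>. open V \<and> V \<inter> A \<noteq> {}) \<and>
        (\<forall>\<^sub>F i in F. \<exists>V\<in>\<V>. \<forall>x\<in>V \<inter> A. \<bar>f (act (a i) x) - f (act (b i) x)\<bar> \<le> \<kappa>)"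
      using V(1,2) by blast
  qed (auto intro!: continuous_intros fact)
qed


section \<open>A criterion for \<open>E\<close>-compatibility\<close>

lemma enveloping_semigroup_limit:
  assumes "p \<in> enveloping_semigroup Q act"
  obtains F where "F \<noteq> bot" "\<And>y. y \<in> topspace Q \<Longrightarrow> limitin Q (\<lambda>s. act s y) (p y) F"
proof -
  define T where "T = product_topology (\<lambda>_. Q) (topspace Q)"
  define e where "e s = restrict (act s) (topspace Q)" for s
  have p: "p \<in> T closure_of range e" using assms by (simp add: enveloping_semigroup_def T_def e_def)
  define F where "F = filtercomap e (nhdsin T p)"
  have "F \<noteq> bot" unfolding F_def
  proof (rule filtercomap_neq_bot)
    fix P assume "eventually P (nhdsin T p)"
    then obtain U where "openin T U" "p \<in> U" "\<And>g. g \<in> U \<Longrightarrow> P g"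
      using p by (auto simp: eventually_nhdsin in_closure_of)
    moreover have "range e \<inter> U \<noteq> {}" using p calculation(1,2) by (auto simp: in_closure_of)
    ultimately show "\<exists>s. P (e s)" by blast
  qed
  moreover have "limitin T e p F"
    unfolding limitin_def
  proof (intro conjI allI impI)
    show "p \<in> topspace T" using p by (simp add: in_closure_of)
    fix U assume "openin T U \<and> p \<in> U"
    then have "\<forall>\<^sub>F g in nhdsin T p. g \<in> U" unfolding eventually_nhdsin by blast
    then show "\<forall>\<^sub>F s in F. e s \<in> U" unfolding F_def by (rule eventually_filtercomapI)
  qed
  then have "limitin Q (\<lambda>s. act s y) (p y) F" if "y \<in> topspace Q" for y
    using that by (auto simp: T_def limitin_componentwise e_def)
  ultimately show thesis using that by blast
qed

text \<open>Two elements of the enveloping semigroup that agree on the image of \<open>X\<close> are limits along filters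
  \<open>F\<close> and \<open>G\<close> of translations. Along the product filter the difference of the two translations tends
  to \<open>0\<close> pointwise on \<open>X\<close>, and by dominated convergence at every point of \<open>Q\<close>.\<close>

lemma tame_E_compatible:
  fixes act :: "'s::semitopological_monoid \<Rightarrow> 'x::t2_space \<Rightarrow> 'x" and Q :: "'q topology"
  assumes sys: "compact_system euclidean act" and tame: "tame euclidean act"
    and \<alpha>: "\<And>x. \<alpha> x \<in> topspace Q"
    and cont: "\<And>h. h \<in> H \<Longrightarrow> continuous_map Q euclideanreal h"
    and sep: "\<And>y z. y \<in> topspace Q \<Longrightarrow> z \<in> topspace Q \<Longrightarrow> (\<And>h. h \<in> H \<Longrightarrow> h y = h z) \<Longrightarrow> y = z"
    and orbit: "\<And>h. h \<in> H \<Longrightarrow>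
      \<exists>f. continuous_on UNIV f \<and> (\<forall>s x. h (actQ s (\<alpha> x)) = f (act s x))"
    and dom: "\<And>h y. h \<in> H \<Longrightarrow> y \<in> topspace Q \<Longrightarrow> \<exists>L. cone_functional L \<and>
      (\<forall>s t. \<bar>h (actQ s y) - h (actQ t y)\<bar> \<le> L (\<lambda>x. \<bar>h (actQ s (\<alpha> x)) - h (actQ t (\<alpha> x))\<bar>))"
  shows "E_compatible euclidean Q actQ \<alpha>"
  unfolding E_compatible_def
proof (rule inj_onI)
  let ?Y = "Q closure_of (\<alpha> ` topspace euclidean)"
  fix p q assume p: "p \<in> enveloping_semigroup Q actQ" and q: "q \<in> enveloping_semigroup Q actQ"
    and eq: "restrict p ?Y = restrict q ?Y"
  have pq: "p (\<alpha> x) = q (\<alpha> x)" for x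
  proof -
    have "\<alpha> x \<in> ?Y" using closure_of_subset[of "range \<alpha>" Q] \<alpha> by auto
    then show ?thesis using eq by (metis restrict_apply')
  qed
  have ext: "p \<in> topspace Q \<rightarrow>\<^sub>E topspace Q" "q \<in> topspace Q \<rightarrow>\<^sub>E topspace Q"
    using p q closure_of_subset_topspace[THEN subsetD] unfolding enveloping_semigroup_def
    by (simp_all only: topspace_product_topology[symmetric])
  obtain F where F: "F \<noteq> bot" "\<And>y. y \<in> topspace Q \<Longrightarrow> limitin Q (\<lambda>s. actQ s y) (p y) F"
    using enveloping_semigroup_limit[OF p] by blast
  obtain G where G: "G \<noteq> bot" "\<And>y. y \<in> topspace Q \<Longrightarrow> limitin Q (\<lambda>s. actQ s y) (q y) G"
    using enveloping_semigroup_limit[OF q] by blast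
  have lim: "((\<lambda>i. h (actQ (fst i) y) - h (actQ (snd i) y)) \<longlongrightarrow> h (p y) - h (q y)) (F \<times>\<^sub>F G)"
    if "h \<in> H" "y \<in> topspace Q" for h y
  proof -
    have "((\<lambda>s. h (actQ s y)) \<longlongrightarrow> h (p y)) F" "((\<lambda>s. h (actQ s y)) \<longlongrightarrow> h (q y)) G"
      using continuous_map_limit[OF cont[OF that(1)] F(2)[OF that(2)]]
        continuous_map_limit[OF cont[OF that(1)] G(2)[OF that(2)]] by (simp_all add: o_def)
    from filterlim_compose[OF this(1) filterlim_fst] filterlim_compose[OF this(2) filterlim_snd]
    show ?thesis by (rule tendsto_diff)
  qed
  have "p y = q y" if y: "y \<in> topspace Q" for y
  proof (rule sep)
    show "p y \<in> topspace Q" "q y \<in> topspace Q" using ext y by auto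
    fix h assume h: "h \<in> H"
    obtain f where f: "continuous_on UNIV f" "\<And>s x. h (actQ s (\<alpha> x)) = f (act s x)"
      using orbit[OF h] by blast
    obtain L where L: "cone_functional L" and
      le: "\<And>s t. \<bar>h (actQ s y) - h (actQ t y)\<bar> \<le> L (\<lambda>x. \<bar>f (act s x) - f (act t x)\<bar>)"
      using dom[OF h y] unfolding f(2) by blast
    have "((\<lambda>i. f (act (fst i) x) - f (act (snd i) x)) \<longlongrightarrow> 0) (F \<times>\<^sub>F G)" for x
      using lim[OF h \<alpha>, of x] pq by (simp add: f(2))
    from tame_dominated_convergence[OF sys tame f(1) L this]
    have "((\<lambda>i. h (actQ (fst i) y) - h (actQ (snd i) y)) \<longlongrightarrow> 0) (F \<times>\<^sub>F G)"
      by (rule Lim_null_comparison[rotated]) (simp add: le)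
    with lim[OF h y] have "h (p y) - h (q y) = 0"
      by (rule tendsto_unique[rotated]) (use F(1) G(1) in \<open>simp add: prod_filter_eq_bot\<close>)
    then show "h (p y) = h (q y)" by simp
  qed
  then show "p = q" using ext by (auto intro: PiE_ext)
qed


section \<open>Weak right uniform continuity\<close>

text \<open>The variation of a bounded functional replaces its representing signed measure: it is positive
  and dominates the functional. Additivity is the Riesz decomposition property of \<open>C(X)\<close>.\<close>

definition variation :: "(('a::topological_space \<Rightarrow>\<^sub>C real) \<Rightarrow>\<^sub>L real) \<Rightarrow> ('a \<Rightarrow> real) \<Rightarrow> real" where
  "variation \<Lambda> u = (SUP g\<in>{g. \<forall>x. \<bar>apply_bcontfun g x\<bar> \<le> u x}. blinfun_apply \<Lambda> g)"

context
  fixes \<Lambda> :: "('a::t2_space \<Rightarrow>\<^sub>C real) \<Rightarrow>\<^sub>L real"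
  assumes X: "compact (UNIV :: 'a set)"
begin

lemma bdd_above_variation:
  assumes "continuous_on UNIV u"
  shows "bdd_above (blinfun_apply \<Lambda> ` {g. \<forall>x. \<bar>apply_bcontfun g x\<bar> \<le> u x})"
proof -
  obtain M where M: "\<And>x. \<bar>u x\<bar> \<le> M" using compact_bounded[OF X assms] by blast
  show ?thesis
  proof (rule bdd_aboveI2)
    fix g assume "g \<in> {g. \<forall>x. \<bar>apply_bcontfun g x\<bar> \<le> u x}"
    then have "norm (apply_bcontfun g x) \<le> M" for x
      using M[of x] by (auto simp: abs_le_iff intro: order_trans)
    then have "norm g \<le> M" by (rule norm_bound)
    then have "norm \<Lambda> * norm g \<le> norm \<Lambda> * M" by (intro mult_left_mono) auto
    then show "blinfun_apply \<Lambda> g \<le> norm \<Lambda> * M" using norm_blinfun[of \<Lambda> g] by simp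
  qed
qed

lemma le_variation:
  "continuous_on UNIV u \<Longrightarrow> (\<And>x. \<bar>apply_bcontfun g x\<bar> \<le> u x) \<Longrightarrow> blinfun_apply \<Lambda> g \<le> variation \<Lambda> u"
  unfolding variation_def by (rule cSUP_upper[OF _ bdd_above_variation]) auto

lemma abs_le_variation:
  assumes "continuous_on UNIV u" "\<And>x. \<bar>apply_bcontfun g x\<bar> \<le> u x"
  shows "\<bar>blinfun_apply \<Lambda> g\<bar> \<le> variation \<Lambda> u"
  using le_variation[OF assms] le_variation[of u "- g"] assms by (simp add: abs_le_iff blinfun.minus_right)

lemma variation_le:
  assumes "\<And>x. 0 \<le> u x" "\<And>g. (\<And>x. \<bar>apply_bcontfun g x\<bar> \<le> u x) \<Longrightarrow> blinfun_apply \<Lambda> g \<le> c"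
  shows "variation \<Lambda> u \<le> c"
  unfolding variation_def
proof (rule cSUP_least)
  have "0 \<in> {g. \<forall>x. \<bar>apply_bcontfun g x\<bar> \<le> u x}" using assms(1) by simp
  then show "{g. \<forall>x. \<bar>apply_bcontfun g x\<bar> \<le> u x} \<noteq> {}" by blast
qed (use assms(2) in auto)

lemma cone_functional_variation: "cone_functional (variation \<Lambda>)"
proof
  fix u v :: "'a \<Rightarrow> real"
  assume u: "continuous_on UNIV u" "\<And>x. 0 \<le> u x" and v: "continuous_on UNIV v" "\<And>x. 0 \<le> v x"
  have uv: "continuous_on UNIV (\<lambda>x. u x + v x)" using u v by (intro continuous_intros)
  show "variation \<Lambda> (\<lambda>x. u x + v x) = variation \<Lambda> u + variation \<Lambda> v"
  proof (rule antisym)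
    show "variation \<Lambda> (\<lambda>x. u x + v x) \<le> variation \<Lambda> u + variation \<Lambda> v"
    proof (rule variation_le)
      fix g :: "'a \<Rightarrow>\<^sub>C real" assume g: "\<And>x. \<bar>apply_bcontfun g x\<bar> \<le> u x + v x"
      define g1 where "g1 = Bcontfun (\<lambda>x. max (- u x) (min (u x) (apply_bcontfun g x)))"
      have g1: "apply_bcontfun g1 = (\<lambda>x. max (- u x) (min (u x) (apply_bcontfun g x)))"
        unfolding g1_def using u by (intro apply_Bcontfun X continuous_intros) auto
      have "blinfun_apply \<Lambda> g1 \<le> variation \<Lambda> u"
        using u by (intro le_variation) (auto simp: g1 abs_le_iff)
      moreover have "blinfun_apply \<Lambda> (g - g1) \<le> variation \<Lambda> v"
      proof (rule le_variation[OF v(1)])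
        show "\<bar>apply_bcontfun (g - g1) x\<bar> \<le> v x" for x
          using g[of x] u(2)[of x] v(2)[of x] by (simp add: g1)
      qed
      ultimately show "blinfun_apply \<Lambda> g \<le> variation \<Lambda> u + variation \<Lambda> v"
        by (simp add: blinfun.diff_right)
    qed (use u v in auto)
    have "variation \<Lambda> u \<le> variation \<Lambda> (\<lambda>x. u x + v x) - variation \<Lambda> v"
    proof (rule variation_le[OF u(2)])
      fix g :: "'a \<Rightarrow>\<^sub>C real" assume g: "\<And>x. \<bar>apply_bcontfun g x\<bar> \<le> u x"
      have "variation \<Lambda> v \<le> variation \<Lambda> (\<lambda>x. u x + v x) - blinfun_apply \<Lambda> g"
      proof (rule variation_le[OF v(2)])
        fix k :: "'a \<Rightarrow>\<^sub>C real" assume k: "\<And>x. \<bar>apply_bcontfun k x\<bar> \<le> v x"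
        have "blinfun_apply \<Lambda> (g + k) \<le> variation \<Lambda> (\<lambda>x. u x + v x)"
        proof (rule le_variation[OF uv])
          show "\<bar>apply_bcontfun (g + k) x\<bar> \<le> u x + v x" for x using g[of x] k[of x] by simp
        qed
        then show "blinfun_apply \<Lambda> k \<le> variation \<Lambda> (\<lambda>x. u x + v x) - blinfun_apply \<Lambda> g"
          by (simp add: blinfun.add_right)
      qed
      then show "blinfun_apply \<Lambda> g \<le> variation \<Lambda> (\<lambda>x. u x + v x) - variation \<Lambda> v" by simp
    qed
    then show "variation \<Lambda> u + variation \<Lambda> v \<le> variation \<Lambda> (\<lambda>x. u x + v x)" by simp
  qed
next
  fix u :: "'a \<Rightarrow> real" and c :: real
  assume u: "continuous_on UNIV u" "\<And>x. 0 \<le> u x" and "0 \<le> c"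
  have le: "c * variation \<Lambda> w \<le> variation \<Lambda> (\<lambda>x. c * w x)"
    if "0 < c" and w: "continuous_on UNIV w" "\<And>x. 0 \<le> w x" for c and w :: "'a \<Rightarrow> real"
  proof -
    have "variation \<Lambda> w \<le> variation \<Lambda> (\<lambda>x. c * w x) / c"
    proof (rule variation_le[OF w(2)])
      fix g :: "'a \<Rightarrow>\<^sub>C real" assume g: "\<And>x. \<bar>apply_bcontfun g x\<bar> \<le> w x"
      have "blinfun_apply \<Lambda> (c *\<^sub>R g) \<le> variation \<Lambda> (\<lambda>x. c * w x)"
        using w g \<open>0 < c\<close> by (intro le_variation) (auto intro!: continuous_intros simp: abs_mult)
      then show "blinfun_apply \<Lambda> g \<le> variation \<Lambda> (\<lambda>x. c * w x) / c"
        using \<open>0 < c\<close> by (simp add: blinfun.scaleR_right field_simps)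
    qed
    then show ?thesis using \<open>0 < c\<close> by (simp add: field_simps)
  qed
  show "variation \<Lambda> (\<lambda>x. c * u x) = c * variation \<Lambda> u"
  proof (cases "c = 0")
    case True
    have "g = 0" if "\<And>x. \<bar>apply_bcontfun g x\<bar> \<le> 0" for g :: "'a \<Rightarrow>\<^sub>C real"
      using that by (intro bcontfun_eqI) auto
    then have "{g. \<forall>x. \<bar>apply_bcontfun g x\<bar> \<le> 0} = {0 :: 'a \<Rightarrow>\<^sub>C real}" by auto
    then show ?thesis using True by (simp add: variation_def)
  next
    case False
    then have "0 < c" using \<open>0 \<le> c\<close> by simp
    have "inverse c * variation \<Lambda> (\<lambda>x. c * u x) \<le> variation \<Lambda> (\<lambda>x. inverse c * (c * u x))"
      using \<open>0 < c\<close> u by (intro le) (auto intro!: continuous_intros)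
    then have "variation \<Lambda> (\<lambda>x. c * u x) \<le> c * variation \<Lambda> u" using \<open>0 < c\<close> by (simp add: field_simps)
    then show ?thesis using le[OF \<open>0 < c\<close> u] by simp
  qed
next
  fix u :: "'a \<Rightarrow> real" assume "continuous_on UNIV u" "\<And>x. 0 \<le> u x"
  then show "0 \<le> variation \<Lambda> u" using le_variation[of u 0] by (simp add: blinfun.zero_right)
qed

end

theorem tame_WRUC:
  fixes act :: "'s::semitopological_monoid \<Rightarrow> 'x::t2_space \<Rightarrow> 'x"
  assumes sys: "compact_system euclidean act" and tame: "tame euclidean act"
  shows "WRUC act"
  unfolding WRUC_def weak_topology_def
proof (intro allI continuous_map_pullback')
  fix f :: "'x \<Rightarrow>\<^sub>C real"
  have X: "compact (UNIV :: 'x set)" using sys by (simp add: compact_system_def compact_space_def)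
  have act: "continuous_on UNIV (act s)" "continuous_on UNIV (\<lambda>s. act s x)" for s x
    using sys by (simp_all add: compact_system_def)
  have fact: "continuous_on UNIV (\<lambda>x. apply_bcontfun f (act s x))" for s
    by (rule continuous_on_compose2[OF continuous_on_apply_bcontfun act(1)]) auto
  define T where "T s = Bcontfun (\<lambda>x. apply_bcontfun f (act s x))" for s
  have T: "apply_bcontfun (T s) = (\<lambda>x. apply_bcontfun f (act s x))" for s
    unfolding T_def by (rule apply_Bcontfun[OF X fact])
  have "continuous_on UNIV (\<lambda>s. blinfun_apply \<Lambda> (T s))" for \<Lambda> :: "('x \<Rightarrow>\<^sub>C real) \<Rightarrow>\<^sub>L real"
    unfolding continuous_on_def
  proof
    fix s0 :: 's
    have "((\<lambda>s. apply_bcontfun f (act s x) - apply_bcontfun f (act s0 x)) \<longlongrightarrow> 0) (at s0)" for x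
    proof -
      have "continuous_on UNIV (\<lambda>s. apply_bcontfun f (act s x))"
        by (rule continuous_on_compose2[OF continuous_on_apply_bcontfun act(2)]) auto
      then show ?thesis by (simp add: continuous_on_def LIM_zero)
    qed
    from tame_dominated_convergence[OF sys tame continuous_on_apply_bcontfun
        cone_functional_variation[OF X, of \<Lambda>] this]
    have "((\<lambda>s. blinfun_apply \<Lambda> (T s) - blinfun_apply \<Lambda> (T s0)) \<longlongrightarrow> 0) (at s0)"
    proof (rule Lim_null_comparison[rotated], intro always_eventually allI)
      fix s
      have "\<bar>blinfun_apply \<Lambda> (T s - T s0)\<bar> \<le>
          variation \<Lambda> (\<lambda>x. \<bar>apply_bcontfun f (act s x) - apply_bcontfun f (act s0 x)\<bar>)"
        by (intro abs_le_variation X continuous_intros fact) (simp add: T)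
      then show "norm (blinfun_apply \<Lambda> (T s) - blinfun_apply \<Lambda> (T s0)) \<le>
          variation \<Lambda> (\<lambda>x. \<bar>apply_bcontfun f (act s x) - apply_bcontfun f (act s0 x)\<bar>)"
        by (simp add: blinfun.diff_right)
    qed
    then show "((\<lambda>s. blinfun_apply \<Lambda> (T s)) \<longlongrightarrow> blinfun_apply \<Lambda> (T s0)) (at s0 within UNIV)"
      by (simp add: LIM_zero_cancel)
  qed
  then show "continuous_map euclidean (product_topology (\<lambda>_. euclideanreal) UNIV)
      ((\<lambda>v (\<Lambda> :: ('x \<Rightarrow>\<^sub>C real) \<Rightarrow>\<^sub>L real). blinfun_apply \<Lambda> v) \<circ> (\<lambda>s. Bcontfun (\<lambda>x. apply_bcontfun f (act s x))))"
    by (simp add: continuous_map_componentwise_UNIV o_def T_def)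
qed auto


section \<open>Regular probability measures\<close>

text \<open>By regularity it suffices to compare the measures on compact sets \<open>K\<close>; for these, Urysohn functions
  give \<open>\<mu> K \<le> 1 - \<nu> C\<close> for every compact \<open>C\<close> disjoint from \<open>K\<close>.\<close>

lemma prob_measures_eqI:
  fixes \<mu> \<nu> :: "'a::t2_space measure"
  assumes X: "compact (UNIV :: 'a set)" and \<mu>: "\<mu> \<in> prob_measures" and \<nu>: "\<nu> \<in> prob_measures"
    and eq: "\<And>f :: 'a \<Rightarrow>\<^sub>C real. (\<integral>x. apply_bcontfun f x \<partial>\<mu>) = (\<integral>x. apply_bcontfun f x \<partial>\<nu>)"
  shows "\<mu> = \<nu>"
proof -
  have le: "emeasure \<mu> K \<le> emeasure \<nu> K"
    if \<mu>: "\<mu> \<in> prob_measures" and \<nu>: "\<nu> \<in> prob_measures" and K: "compact K"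
      and eq: "\<And>f :: 'a \<Rightarrow>\<^sub>C real. (\<integral>x. apply_bcontfun f x \<partial>\<mu>) = (\<integral>x. apply_bcontfun f x \<partial>\<nu>)"
    for \<mu> \<nu> :: "'a measure" and K
  proof -
    interpret \<mu>: prob_space \<mu> using \<mu> by (simp add: prob_measures_def)
    interpret \<nu>: prob_space \<nu> using \<nu> by (simp add: prob_measures_def)
    have s[measurable_cong]: "sets \<mu> = sets borel" "sets \<nu> = sets borel" using \<mu> \<nu> by (simp_all add: prob_measures_def)
    have sp: "space \<mu> = UNIV" "space \<nu> = UNIV" using sets_eq_imp_space_eq[OF s(1)] sets_eq_imp_space_eq[OF s(2)] by simp_all
    have [measurable]: "K \<in> sets borel" using K by (simp add: compact_imp_closed)
    have "measure \<nu> C \<le> 1 - measure \<mu> K" if C: "C \<subseteq> - K" "compact C" for C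
    proof -
      have [measurable]: "C \<in> sets borel" using C by (simp add: compact_imp_closed)
      obtain f where f: "continuous_on UNIV f" "\<And>x. 0 \<le> f x" "\<And>x. f x \<le> (1::real)"
        "\<And>x. x \<in> C \<Longrightarrow> f x = 0" "\<And>x. x \<in> K \<Longrightarrow> f x = 1"
        using compact_Urysohn[OF X, of C K] C K by (metis compact_imp_closed disjoint_eq_subset_Compl)
      have [measurable]: "f \<in> borel_measurable borel" by (rule borel_measurable_continuous_onI[OF f(1)])
      have fi: "integrable \<mu> f" "integrable \<nu> f"
        by (rule \<mu>.integrable_const_bound[of _ 1] \<nu>.integrable_const_bound[of _ 1]; use f in \<open>simp; measurable\<close>)+
      have "measure \<mu> K = (\<integral>x. indicator K x \<partial>\<mu>)" by (simp add: sp)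
      also have "\<dots> \<le> (\<integral>x. f x \<partial>\<mu>)"
        by (rule integral_mono) (use fi f in \<open>auto split: split_indicator simp: \<mu>.emeasure_eq_measure\<close>)
      also have "\<dots> = (\<integral>x. f x \<partial>\<nu>)" using eq[of "Bcontfun f"] by (simp add: apply_Bcontfun[OF X f(1)])
      also have "\<dots> \<le> (\<integral>x. indicator (- C) x \<partial>\<nu>)"
        by (rule integral_mono) (use fi f in \<open>auto split: split_indicator simp: \<nu>.emeasure_eq_measure\<close>)
      also have "\<dots> = 1 - measure \<nu> C" using \<nu>.prob_compl[of C] by (simp add: sp Compl_eq_Diff_UNIV)
      finally show ?thesis by simp
    qed
    then have "emeasure \<nu> (- K) \<le> ennreal (1 - measure \<mu> K)"
      using \<nu> by (auto simp: prob_measures_def \<nu>.emeasure_eq_measure intro!: SUP_least ennreal_leI)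
    then have "measure \<nu> (- K) \<le> 1 - measure \<mu> K" by (simp add: \<nu>.emeasure_eq_measure)
    then have "measure \<mu> K \<le> measure \<nu> K" using \<nu>.prob_compl[of K] by (simp add: sp Compl_eq_Diff_UNIV)
    then show ?thesis by (simp add: \<nu>.emeasure_eq_measure \<mu>.emeasure_eq_measure ennreal_leI)
  qed
  have "emeasure \<mu> K = emeasure \<nu> K" if "compact K" for K
    using le[OF \<mu> \<nu> that eq] le[OF \<nu> \<mu> that eq[symmetric]] by simp
  then show ?thesis
    using \<mu> \<nu> by (intro measure_eqI) (auto simp: prob_measures_def intro!: SUP_cong)
qed

lemma return_prob_measures: "return borel x \<in> prob_measures" for x :: "'a::t2_space"
proof -
  have "emeasure (return borel x) B = (SUP K\<in>{K. K \<subseteq> B \<and> compact K}. emeasure (return borel x) K)"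
    if B: "B \<in> sets borel" for B
  proof (rule antisym)
    show "emeasure (return borel x) B \<le> (SUP K\<in>{K. K \<subseteq> B \<and> compact K}. emeasure (return borel x) K)"
    proof (cases "x \<in> B")
      case True
      then show ?thesis using B by (intro SUP_upper2[of "{x}"]) (auto simp: emeasure_return)
    qed (use B in \<open>simp add: emeasure_return\<close>)
  next
    show "(SUP K\<in>{K. K \<subseteq> B \<and> compact K}. emeasure (return borel x) K) \<le> emeasure (return borel x) B"
      using B by (intro SUP_least emeasure_mono) auto
  qed
  then show ?thesis by (simp add: prob_measures_def prob_space_return)
qed

lemma cone_functional_integral:
  fixes \<mu> :: "'a::t2_space measure"
  assumes X: "compact (UNIV :: 'a set)" and "finite_measure \<mu>" "sets \<mu> = sets borel"
  shows "cone_functional (\<lambda>u. \<integral>x. u x \<partial>\<mu>)"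
proof
  interpret finite_measure \<mu> by fact
  have int: "integrable \<mu> u" if u: "continuous_on UNIV u" for u :: "'a \<Rightarrow> real"
  proof -
    obtain M where "\<And>x. \<bar>u x\<bar> \<le> M" using compact_bounded[OF X u] by blast
    then show ?thesis using borel_measurable_continuous_onI[OF u] assms(3)
      by (intro integrable_const_bound[of _ M]) (auto cong: measurable_cong_sets)
  qed
  show "(\<integral>x. u x + v x \<partial>\<mu>) = (\<integral>x. u x \<partial>\<mu>) + (\<integral>x. v x \<partial>\<mu>)"
    if "continuous_on UNIV u" "continuous_on UNIV v" for u v :: "'a \<Rightarrow> real"
    using int that by simp
qed (auto intro: integral_nonneg)

theorem tame_prob_E_compatible:
  fixes act :: "'s::semitopological_monoid \<Rightarrow> 'x::t2_space \<Rightarrow> 'x"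
  assumes sys: "compact_system euclidean act" and tame: "tame euclidean act"
  shows "E_compatible euclidean prob_topology (prob_action act) (\<lambda>x. return borel x)"
proof (rule tame_E_compatible[OF sys tame, where H = "range (\<lambda>(f :: 'x \<Rightarrow>\<^sub>C real) \<mu>. \<integral>x. apply_bcontfun f x \<partial>\<mu>)"])
  have X: "compact (UNIV :: 'x set)" using sys by (simp add: compact_system_def compact_space_def)
  have act: "continuous_on UNIV (act s)" for s using sys by (simp add: compact_system_def)
  have fact: "continuous_on UNIV (\<lambda>x. apply_bcontfun f (act s x))" for s and f :: "'x \<Rightarrow>\<^sub>C real"
    by (rule continuous_on_compose2[OF continuous_on_apply_bcontfun act]) auto
  have m: "act s \<in> borel \<rightarrow>\<^sub>M borel" for s by (rule borel_measurable_continuous_onI[OF act])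
  have fm: "apply_bcontfun f \<in> borel_measurable borel" for f :: "'x \<Rightarrow>\<^sub>C real"
    by (rule borel_measurable_continuous_onI) simp
  have top: "topspace prob_topology = (prob_measures :: 'x measure set)"
    by (simp add: prob_topology_def topspace_pullback_topology)
  have int: "(\<integral>x. apply_bcontfun f x \<partial>prob_action act s \<mu>) = (\<integral>x. apply_bcontfun f (act s x) \<partial>\<mu>)"
    if "sets \<mu> = sets borel" for f :: "'x \<Rightarrow>\<^sub>C real" and s and \<mu> :: "'x measure"
    unfolding prob_action_def using that m[of s] fm[of f]
    by (intro integral_distr) (auto cong: measurable_cong_sets)
  have int_return: "(\<integral>x. apply_bcontfun f x \<partial>prob_action act s (return borel x)) = apply_bcontfun f (act s x)"
    for f :: "'x \<Rightarrow>\<^sub>C real" and s x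
    by (subst int) (auto intro!: integral_return borel_measurable_continuous_onI fact)
  show "return borel x \<in> topspace prob_topology" for x :: 'x by (simp add: top return_prob_measures)
  show "continuous_map prob_topology euclideanreal h"
    if h: "h \<in> range (\<lambda>(f :: 'x \<Rightarrow>\<^sub>C real) \<mu>. \<integral>x. apply_bcontfun f x \<partial>\<mu>)" for h
  proof -
    obtain f :: "'x \<Rightarrow>\<^sub>C real" where h: "h = (\<lambda>\<mu>. \<integral>x. apply_bcontfun f x \<partial>\<mu>)" using h by blast
    have "continuous_map prob_topology euclideanreal
      ((\<lambda>\<phi>. \<phi> f) \<circ> (\<lambda>\<mu> (f :: 'x \<Rightarrow>\<^sub>C real). \<integral>x. apply_bcontfun f x \<partial>\<mu>))"
      unfolding prob_topology_def
      by (intro continuous_map_pullback continuous_map_product_projection) auto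
    then show ?thesis by (simp add: h o_def)
  qed
  show "\<mu> = \<nu>" if "\<mu> \<in> topspace prob_topology" "\<nu> \<in> topspace prob_topology"
    "\<And>h. h \<in> range (\<lambda>(f :: 'x \<Rightarrow>\<^sub>C real) \<mu>. \<integral>x. apply_bcontfun f x \<partial>\<mu>) \<Longrightarrow> h \<mu> = h \<nu>" for \<mu> \<nu> :: "'x measure"
    using that(1,2) that(3)[OF rangeI] by (intro prob_measures_eqI X) (simp_all add: top)
  show "\<exists>f. continuous_on UNIV f \<and> (\<forall>s x. h (prob_action act s (return borel x)) = f (act s x))"
    if "h \<in> range (\<lambda>(f :: 'x \<Rightarrow>\<^sub>C real) \<mu>. \<integral>x. apply_bcontfun f x \<partial>\<mu>)" for h
    using that by (auto simp: int_return intro: continuous_on_apply_bcontfun)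
  fix h and \<mu> :: "'x measure"
  assume "h \<in> range (\<lambda>(f :: 'x \<Rightarrow>\<^sub>C real) \<mu>. \<integral>x. apply_bcontfun f x \<partial>\<mu>)" and "\<mu> \<in> topspace prob_topology"
  then obtain f :: "'x \<Rightarrow>\<^sub>C real" where h: "h = (\<lambda>\<mu>. \<integral>x. apply_bcontfun f x \<partial>\<mu>)"
    and \<mu>: "finite_measure \<mu>" "sets \<mu> = sets borel"
    by (auto simp: top prob_measures_def prob_space.finite_measure)
  interpret finite_measure \<mu> by fact
  have i: "integrable \<mu> (\<lambda>x. apply_bcontfun f (act s x))" for s
  proof -
    obtain M where "\<And>x. \<bar>apply_bcontfun f (act s x)\<bar> \<le> M" using compact_bounded[OF X fact] by blast
    then show ?thesis using borel_measurable_continuous_onI[OF fact] \<mu>(2)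
      by (intro integrable_const_bound[of _ M]) (auto cong: measurable_cong_sets)
  qed
  have "\<bar>h (prob_action act s \<mu>) - h (prob_action act t \<mu>)\<bar> \<le>
      (\<integral>x. \<bar>h (prob_action act s (return borel x)) - h (prob_action act t (return borel x))\<bar> \<partial>\<mu>)" for s t
    unfolding h int_return int[OF \<mu>(2)]
    using integral_abs_bound[of \<mu> "\<lambda>x. apply_bcontfun f (act s x) - apply_bcontfun f (act t x)"] i by simp
  then show "\<exists>L. cone_functional L \<and> (\<forall>s t. \<bar>h (prob_action act s \<mu>) - h (prob_action act t \<mu>)\<bar> \<le>
      L (\<lambda>x. \<bar>h (prob_action act s (return borel x)) - h (prob_action act t (return borel x))\<bar>))"
    using cone_functional_integral[OF X \<mu>] by blast
qed


section \<open>Sublinear functionals\<close>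

definition sublinear :: "('v::real_vector \<Rightarrow> real) \<Rightarrow> bool" where
  "sublinear p \<longleftrightarrow> (\<forall>x y. p (x + y) \<le> p x + p y) \<and> (\<forall>c\<ge>0. \<forall>x. p (c *\<^sub>R x) = c * p x)"

lemma sublinear_add: "sublinear p \<Longrightarrow> p (x + y) \<le> p x + p y"
  and sublinear_scale: "sublinear p \<Longrightarrow> 0 \<le> c \<Longrightarrow> p (c *\<^sub>R x) = c * p x"
  and sublinear_zero: "sublinear p \<Longrightarrow> p 0 = 0"
  unfolding sublinear_def by (auto dest: spec[of _ 0])

lemma sublinear_ge_minus: "sublinear p \<Longrightarrow> - p (- x) \<le> p x"
  using sublinear_add[of p x "- x"] sublinear_zero[of p] by simp

lemma sublinearI:
  assumes "\<And>x y. p (x + y) \<le> p x + p y" and le: "\<And>c x. 0 < c \<Longrightarrow> p (c *\<^sub>R x) \<le> c * p x" and "p 0 = 0"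
  shows "sublinear p"
  unfolding sublinear_def
proof (intro conjI allI impI)
  fix c :: real and x assume "0 \<le> c"
  show "p (c *\<^sub>R x) = c * p x"
  proof (cases "c = 0")
    case False
    then have "0 < c" using \<open>0 \<le> c\<close> by simp
    then have "p x \<le> inverse c * p (c *\<^sub>R x)" using le[of "inverse c" "c *\<^sub>R x"] by simp
    then have "c * p x \<le> p (c *\<^sub>R x)" using \<open>0 < c\<close> by (simp add: field_simps)
    then show ?thesis using le[OF \<open>0 < c\<close>, of x] by simp
  qed (simp add: assms(3))
qed (fact assms(1))

lemma Inf_sublinear:
  assumes ne: "I \<noteq> {}" and bdd: "\<And>x. bdd_below ((\<lambda>i. p i x) ` I)"
    and add: "\<And>i j x y. i \<in> I \<Longrightarrow> j \<in> I \<Longrightarrow> \<exists>k\<in>I. p k (x + y) \<le> p i x + p j y"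
    and scale: "\<And>i c x. i \<in> I \<Longrightarrow> 0 < c \<Longrightarrow> \<exists>k\<in>I. p k (c *\<^sub>R x) \<le> c * p i x"
    and zero: "(INF i\<in>I. p i 0) = 0"
  shows "sublinear (\<lambda>x. INF i\<in>I. p i x)"
proof (rule sublinearI)
  fix x y
  have sum_le: "(INF k\<in>I. p k (x + y)) \<le> p i x + p j y" if "i \<in> I" "j \<in> I" for i j
    using add[OF that, of x y] cINF_lower[OF bdd, of _ "x + y"] by (meson order_trans)
  have "(INF k\<in>I. p k (x + y)) - p i x \<le> (INF j\<in>I. p j y)" if "i \<in> I" for i
  proof (rule cINF_greatest[OF ne])
    fix j assume "j \<in> I"
    from sum_le[OF that this] show "(INF k\<in>I. p k (x + y)) - p i x \<le> p j y" by simp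
  qed
  then have "(INF k\<in>I. p k (x + y)) - (INF j\<in>I. p j y) \<le> (INF i\<in>I. p i x)"
    by (intro cINF_greatest[OF ne]) (simp add: diff_le_eq add.commute)
  then show "(INF i\<in>I. p i (x + y)) \<le> (INF i\<in>I. p i x) + (INF i\<in>I. p i y)" by simp
next
  fix c :: real and x assume "0 < c"
  have "(INF k\<in>I. p k (c *\<^sub>R x)) \<le> c * p i x" if "i \<in> I" for i
    using scale[OF that \<open>0 < c\<close>, of x] cINF_lower[OF bdd, of _ "c *\<^sub>R x"] by (meson order_trans)
  then have "(INF k\<in>I. p k (c *\<^sub>R x)) / c \<le> (INF i\<in>I. p i x)"
    using \<open>0 < c\<close> by (intro cINF_greatest[OF ne]) (simp add: field_simps)
  then show "(INF k\<in>I. p k (c *\<^sub>R x)) \<le> c * (INF i\<in>I. p i x)" using \<open>0 < c\<close> by (simp add: field_simps)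
qed (fact zero)

text \<open>For sublinear \<open>p\<close> this is the largest function \<open>q \<le> p\<close> with \<open>q (x + a) = q x + p a\<close> for all \<open>x\<close>.
  A linear functional below it necessarily takes the value \<open>p a\<close> at \<open>a\<close>.\<close>

definition ray_inf :: "('v::real_vector \<Rightarrow> real) \<Rightarrow> 'v \<Rightarrow> 'v \<Rightarrow> real" where
  "ray_inf p a x = (INF t\<in>{0..}. p (x + t *\<^sub>R a) - t * p a)"

lemma bdd_below_ray:
  assumes "sublinear p"
  shows "bdd_below ((\<lambda>t. p (x + t *\<^sub>R a) - t * p a) ` {0..})"
proof (rule bdd_belowI2)
  fix t :: real assume "t \<in> {0..}"
  then have "t * p a = p (t *\<^sub>R a)" using sublinear_scale[OF assms] by simp
  also have "\<dots> = p ((x + t *\<^sub>R a) + - x)" by simp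
  also have "\<dots> \<le> p (x + t *\<^sub>R a) + p (- x)" by (rule sublinear_add[OF assms])
  finally show "- p (- x) \<le> p (x + t *\<^sub>R a) - t * p a" by simp
qed

lemma ray_inf_le: "sublinear p \<Longrightarrow> 0 \<le> t \<Longrightarrow> ray_inf p a x \<le> p (x + t *\<^sub>R a) - t * p a"
  unfolding ray_inf_def by (rule cINF_lower[OF bdd_below_ray]) auto

lemma sublinear_ray_inf:
  assumes p: "sublinear p"
  shows "sublinear (ray_inf p a)"
  unfolding ray_inf_def[abs_def]
proof (rule Inf_sublinear)
  fix t r :: real and x y assume "t \<in> {0..}" "r \<in> {0..}"
  moreover have "p ((x + t *\<^sub>R a) + (y + r *\<^sub>R a)) \<le> p (x + t *\<^sub>R a) + p (y + r *\<^sub>R a)" by (rule sublinear_add[OF p])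
  ultimately show "\<exists>k\<in>{0..}. p (x + y + k *\<^sub>R a) - k * p a \<le> (p (x + t *\<^sub>R a) - t * p a) + (p (y + r *\<^sub>R a) - r * p a)"
    by (intro bexI[of _ "t + r"]) (auto simp: algebra_simps)
next
  fix t c :: real and x assume "t \<in> {0..}" "0 < c"
  moreover have "p (c *\<^sub>R (x + t *\<^sub>R a)) = c * p (x + t *\<^sub>R a)" using \<open>0 < c\<close> by (simp add: sublinear_scale[OF p])
  ultimately show "\<exists>k\<in>{0..}. p (c *\<^sub>R x + k *\<^sub>R a) - k * p a \<le> c * (p (x + t *\<^sub>R a) - t * p a)"
    by (intro bexI[of _ "c * t"]) (auto simp: algebra_simps)
next
  show "(INF t\<in>{0..}. p (0 + t *\<^sub>R a) - t * p a) = 0"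
    by (rule trans[OF INF_cong[OF refl, of _ _ "\<lambda>_. 0"]]) (auto simp: sublinear_scale[OF p])
qed (auto simp: bdd_below_ray[OF p])

text \<open>The Hahn-Banach theorem in the form that the minimal sublinear functionals are the linear ones:
  for a minimal \<open>m\<close> all functionals \<open>ray_inf m a\<close> coincide with \<open>m\<close>.\<close>

theorem sublinear_dominates_linear:
  fixes p :: "'v::real_vector \<Rightarrow> real"
  assumes p: "sublinear p"
  obtains l where "linear l" "\<And>x. l x \<le> p x"
proof -
  define S where "S = {q. sublinear q \<and> q \<le> p}"
  let ?R = "\<lambda>q r :: 'v \<Rightarrow> real. r \<le> q"
  have "\<exists>m\<in>S. \<forall>q\<in>S. q \<le> m \<longrightarrow> q = m"
  proof (rule predicate_Zorn[where P = ?R])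
    show "partial_order_on S (relation_of ?R S)"
      by (rule partial_order_on_relation_ofI) auto
    fix C assume C: "C \<in> Chains (relation_of ?R S)"
    have CS: "q \<in> S" if "q \<in> C" for q using C that by (auto simp: Chains_def relation_of_def)
    have tot: "q \<le> r \<or> r \<le> q" if "q \<in> C" "r \<in> C" for q r
      using C that by (auto simp: Chains_def relation_of_def)
    show "\<exists>u\<in>S. \<forall>q\<in>C. u \<le> q"
    proof (cases "C = {}")
      case True
      then show ?thesis using p by (auto simp: S_def intro!: bexI[of _ p])
    next
      case False
      have bdd: "bdd_below ((\<lambda>q. q x) ` C)" for x
      proof (rule bdd_belowI2)
        fix q assume "q \<in> C"
        then have "sublinear q" "q (- x) \<le> p (- x)" using CS by (auto simp: S_def le_fun_def)
        then show "- p (- x) \<le> q x" using sublinear_ge_minus[of q x] by simp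
      qed
      have "sublinear (\<lambda>x. INF q\<in>C. q x)"
      proof (rule Inf_sublinear[OF False bdd])
        fix q r x y assume qr: "q \<in> C" "r \<in> C"
        then have sub: "sublinear q" "sublinear r" using CS by (auto simp: S_def)
        from tot[OF qr] show "\<exists>k\<in>C. k (x + y) \<le> q x + r y"
        proof
          assume "q \<le> r"
          then have "q (x + y) \<le> q x + r y"
            using sublinear_add[OF sub(1), of x y] by (simp add: le_fun_def) (meson add_left_mono order_trans)
          then show ?thesis using qr by blast
        next
          assume "r \<le> q"
          then have "r (x + y) \<le> q x + r y"
            using sublinear_add[OF sub(2), of x y] by (simp add: le_fun_def) (meson add_right_mono order_trans)
          then show ?thesis using qr by blast
        qed
      next
        fix q c x assume "q \<in> C" "0 < (c :: real)"
        then show "\<exists>k\<in>C. k (c *\<^sub>R x) \<le> c * q x"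
          using CS sublinear_scale[of q c x] by (intro bexI[of _ q]) (auto simp: S_def)
      next
        have "(INF q\<in>C. q 0) = (INF q\<in>C. 0)"
          by (rule INF_cong) (use CS sublinear_zero in \<open>auto simp: S_def\<close>)
        then show "(INF q\<in>C. q 0) = 0" using False by simp
      qed
      moreover have le: "(\<lambda>x. INF q\<in>C. q x) \<le> q" if "q \<in> C" for q
        using that by (intro le_funI cINF_lower[OF bdd])
      moreover obtain q where "q \<in> C" using False by blast
      then have "(\<lambda>x. INF q\<in>C. q x) \<le> p" using le[of q] CS[of q] by (auto simp: S_def)
      ultimately show ?thesis by (intro bexI[of _ "\<lambda>x. INF q\<in>C. q x"]) (auto simp: S_def)
    qed
  qed
  then obtain m where m: "sublinear m" "m \<le> p" and min: "\<And>q. sublinear q \<Longrightarrow> q \<le> m \<Longrightarrow> q = m"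
    unfolding S_def by (auto intro: order_trans)
  have "ray_inf m a \<le> m" for a using ray_inf_le[OF m(1), of 0 a] by (auto simp: le_fun_def)
  then have "ray_inf m a = m" for a by (intro min sublinear_ray_inf m(1))
  then have "m x + m a \<le> m (x + a)" for x a using ray_inf_le[OF m(1), of 1 a x] by simp
  then have add: "m (x + a) = m x + m a" for x a using sublinear_add[OF m(1)] by (intro antisym)
  have minus: "m (- x) = - m x" for x using add[of x "- x"] sublinear_zero[OF m(1)] by simp
  have "linear m"
  proof (rule linearI)
    fix c :: real and x
    show "m (c *\<^sub>R x) = c *\<^sub>R m x"
    proof (cases "0 \<le> c")
      case False
      then have "m (- (c *\<^sub>R x)) = - c * m x" using sublinear_scale[OF m(1), of "- c" x] by simp
      then show ?thesis by (simp add: minus)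
    qed (simp add: sublinear_scale[OF m(1)])
  qed (fact add)
  then show thesis using that m(2) by (auto simp: le_fun_def)
qed

corollary sublinear_supporting_linear:
  assumes p: "sublinear p"
  obtains l where "linear l" "\<And>x. l x \<le> p x" "l a = p a"
proof -
  obtain l where l: "linear l" "\<And>x. l x \<le> ray_inf p a x"
    using sublinear_dominates_linear[OF sublinear_ray_inf[OF p]] by blast
  have le: "l x \<le> p x" for x using l(2)[of x] ray_inf_le[OF p, of 0 a x] by simp
  have "l (- a) \<le> - p a" using l(2)[of "- a"] ray_inf_le[OF p, of 1 a "- a"] sublinear_zero[OF p] by simp
  then have "l a = p a" using le[of a] linear_neg[OF l(1), of a] by simp
  then show thesis using that l(1) le by blast
qed


section \<open>Continuous functionals on locally convex spaces\<close>

lemma tendsto_scaleR_lcs: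
  fixes x :: "'v::locally_convex_space"
  assumes "(f \<longlongrightarrow> c) F" "(g \<longlongrightarrow> x) F"
  shows "((\<lambda>t. f t *\<^sub>R g t) \<longlongrightarrow> c *\<^sub>R x) F"
  using filterlim_compose[OF tendsto_scaleR_nhds filterlim_Pair[OF assms]] by simp

definition minkowski :: "'v::real_vector set \<Rightarrow> 'v \<Rightarrow> real" where
  "minkowski V x = (INF t\<in>{t. 0 < t \<and> inverse t *\<^sub>R x \<in> V}. t)"

context
  fixes V :: "'v::locally_convex_space set"
  assumes V: "open V" "convex V" "0 \<in> V"
begin

lemma minkowski_set_nonempty: "{t. 0 < t \<and> inverse t *\<^sub>R x \<in> V} \<noteq> {}"
proof -
  have "((\<lambda>r. r *\<^sub>R x) \<longlongrightarrow> 0 *\<^sub>R x) (at_right (0::real))"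
    by (intro tendsto_scaleR_lcs tendsto_const) (rule tendsto_ident_at)
  then have "\<forall>\<^sub>F r in at_right (0::real). r *\<^sub>R x \<in> V" using V by (auto dest: topological_tendstoD)
  then have "\<exists>\<^sub>F r in at_right (0::real). r *\<^sub>R x \<in> V \<and> 0 < r"
    by (intro eventually_frequently eventually_conj eventually_at_right_less) auto
  then obtain r where "r *\<^sub>R x \<in> V" "0 < r" by (blast dest: frequently_ex)
  then have "inverse r \<in> {t. 0 < t \<and> inverse t *\<^sub>R x \<in> V}" by simp
  then show ?thesis by blast
qed

lemma minkowski_le: "0 < t \<Longrightarrow> inverse t *\<^sub>R x \<in> V \<Longrightarrow> minkowski V x \<le> t"
  unfolding minkowski_def by (rule cINF_lower) (auto intro: bdd_belowI[of _ 0])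

lemma minkowski_less:
  assumes "minkowski V x < s"
  obtains t where "0 < t" "t < s" "inverse t *\<^sub>R x \<in> V"
proof -
  have "\<exists>t\<in>{t. 0 < t \<and> inverse t *\<^sub>R x \<in> V}. t < s"
    using assms unfolding minkowski_def
    by (subst (asm) cINF_less_iff[OF minkowski_set_nonempty]) (auto intro: bdd_belowI[of _ 0])
  then show thesis using that by blast
qed

lemma sublinear_minkowski: "sublinear (minkowski V)"
proof (rule sublinearI)
  fix x y
  show "minkowski V (x + y) \<le> minkowski V x + minkowski V y"
  proof (rule field_le_epsilon)
    fix e :: real assume "0 < e"
    obtain t where t: "0 < t" "t < minkowski V x + e / 2" "inverse t *\<^sub>R x \<in> V"
      using minkowski_less[of x "minkowski V x + e / 2"] \<open>0 < e\<close> by auto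
    obtain s where s: "0 < s" "s < minkowski V y + e / 2" "inverse s *\<^sub>R y \<in> V"
      using minkowski_less[of y "minkowski V y + e / 2"] \<open>0 < e\<close> by auto
    have "t / (t + s) + s / (t + s) = 1" using t s by (subst add_divide_distrib[symmetric]) simp
    then have "(t / (t + s)) *\<^sub>R (inverse t *\<^sub>R x) + (s / (t + s)) *\<^sub>R (inverse s *\<^sub>R y) \<in> V"
      using t s by (intro convexD[OF V(2)]) simp_all
    also have "(t / (t + s)) *\<^sub>R (inverse t *\<^sub>R x) + (s / (t + s)) *\<^sub>R (inverse s *\<^sub>R y) = inverse (t + s) *\<^sub>R (x + y)"
    proof -
      have "t / (t + s) * inverse t = inverse (t + s)" "s / (t + s) * inverse s = inverse (t + s)"
        using t(1) s(1) by (simp_all add: divide_inverse)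
      then show ?thesis by (simp only: scaleR_scaleR scaleR_add_right)
    qed
    finally have "minkowski V (x + y) \<le> t + s" using t s by (intro minkowski_le) auto
    then show "minkowski V (x + y) \<le> minkowski V x + minkowski V y + e" using t s by simp
  qed
next
  fix c :: real and x assume "0 < c"
  have "minkowski V (c *\<^sub>R x) / c \<le> minkowski V x"
  proof (rule field_le_epsilon)
    fix e :: real assume "0 < e"
    obtain t where t: "0 < t" "t < minkowski V x + e" "inverse t *\<^sub>R x \<in> V"
      using minkowski_less[of x "minkowski V x + e"] \<open>0 < e\<close> by auto
    have "minkowski V (c *\<^sub>R x) \<le> c * t" using t \<open>0 < c\<close> by (intro minkowski_le) (auto simp: field_simps)
    then have "minkowski V (c *\<^sub>R x) / c \<le> t" using \<open>0 < c\<close> by (simp add: field_simps)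
    then show "minkowski V (c *\<^sub>R x) / c \<le> minkowski V x + e" using t by simp
  qed
  then show "minkowski V (c *\<^sub>R x) \<le> c * minkowski V x" using \<open>0 < c\<close> by (simp add: field_simps)
next
  have "minkowski V 0 \<le> 0 + e" if "0 < e" for e using that V by (simp add: minkowski_le)
  then have "minkowski V 0 \<le> 0" by (rule field_le_epsilon)
  moreover have "0 \<le> minkowski V 0" unfolding minkowski_def
    by (rule cINF_greatest[OF minkowski_set_nonempty]) auto
  ultimately show "minkowski V 0 = 0" by simp
qed

lemma minkowski_ge_1:
  assumes "x \<notin> V"
  shows "1 \<le> minkowski V x"
proof (rule ccontr)
  assume "\<not> ?thesis"
  then obtain t where t: "0 < t" "t < 1" "inverse t *\<^sub>R x \<in> V" using minkowski_less[of x 1] by auto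
  have "t *\<^sub>R (inverse t *\<^sub>R x) + (1 - t) *\<^sub>R 0 \<in> V" using t V by (intro convexD[OF V(2)]) auto
  then show False using t assms by simp
qed

lemma continuous_on_linear_le_minkowski:
  assumes l: "linear l" and le: "\<And>x. l x \<le> minkowski V x"
  shows "continuous_on UNIV l"
  unfolding continuous_on_def
proof (intro ballI tendstoI)
  fix x :: 'v and e :: real assume "0 < e"
  define d where "d = e / 2"
  have "0 < d" "d < e" using \<open>0 < e\<close> by (simp_all add: d_def)
  have small: "l v \<le> 1" if "v \<in> V" for v using le[of v] minkowski_le[of 1 v] that by simp
  have lim: "((\<lambda>y. c *\<^sub>R (y - x)) \<longlongrightarrow> c *\<^sub>R (x - x)) (at x)" for c :: real
    by (rule tendsto_scaleR_lcs[OF tendsto_const tendsto_diff[OF tendsto_ident_at tendsto_const]])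
  have "\<forall>\<^sub>F y in at x. c *\<^sub>R (y - x) \<in> V" for c :: real
    using topological_tendstoD[OF lim V(1), of c] V(3) by simp
  from this[of "inverse d"] this[of "- inverse d"]
  show "\<forall>\<^sub>F y in at x within UNIV. dist (l y) (l x) < e"
  proof eventually_elim
    case (elim y)
    have "inverse d * (l y - l x) \<le> 1" "- (inverse d * (l y - l x)) \<le> 1"
      using small[OF elim(1)] small[OF elim(2)]
      by (simp_all add: linear_scale[OF l] linear_diff[OF l] linear_neg[OF l])
    then have "\<bar>l y - l x\<bar> \<le> d" using \<open>0 < d\<close> by (simp add: field_simps abs_le_iff)
    then show ?case using \<open>d < e\<close> by (simp add: dist_norm)
  qed
qed

end

theorem locally_convex_separating_functional:
  fixes x y :: "'v::locally_convex_space"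
  assumes "x \<noteq> y"
  obtains l where "linear l" "continuous_on UNIV l" "l x \<noteq> (l y :: real)"
proof -
  obtain U where U: "open U" "0 \<in> U" "x - y \<notin> U"
    using t1_space[of 0 "x - y"] assms by auto
  obtain V where V: "open V" "convex V" "0 \<in> V" "V \<subseteq> U"
    using locally_convex_nhds_base[OF U(1,2)] by blast
  obtain l where l: "linear l" "\<And>z. l z \<le> minkowski V z" "l (x - y) = minkowski V (x - y)"
    using sublinear_supporting_linear[OF sublinear_minkowski[OF V(1-3)], of "x - y"] by blast
  have "1 \<le> minkowski V (x - y)" using minkowski_ge_1[OF V(1-3)] U(3) V(4) by blast
  then have "l x \<noteq> l y" using l(3) linear_diff[OF l(1), of x y] by auto
  then show thesis using that l(1) continuous_on_linear_le_minkowski[OF V(1-3) l(1,2)] by blast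
qed


section \<open>Affine compactifications\<close>

definition affine_fun_on :: "'v::real_vector set \<Rightarrow> ('v \<Rightarrow> real) \<Rightarrow> bool" where
  "affine_fun_on Q h \<longleftrightarrow>
     (\<forall>x\<in>Q. \<forall>y\<in>Q. \<forall>u\<ge>0. \<forall>v\<ge>0. u + v = 1 \<longrightarrow> h (u *\<^sub>R x + v *\<^sub>R y) = u * h x + v * h y)"

lemma affine_fun_on_const: "affine_fun_on Q (\<lambda>_. c)"
  unfolding affine_fun_on_def by (simp flip: distrib_right)

lemma affine_fun_on_add: "affine_fun_on Q h \<Longrightarrow> affine_fun_on Q k \<Longrightarrow> affine_fun_on Q (\<lambda>x. h x + k x)"
  unfolding affine_fun_on_def by (simp add: algebra_simps)

lemma affine_fun_on_mult: "affine_fun_on Q h \<Longrightarrow> affine_fun_on Q (\<lambda>x. c * h x)"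
  unfolding affine_fun_on_def by (simp add: algebra_simps)

lemma affine_fun_on_ge:
  fixes Q :: "'v::locally_convex_space set"
  assumes Q: "convex Q" "Q = closure (convex hull B)" and h: "continuous_on Q h" "affine_fun_on Q h"
    and ge: "\<And>y. y \<in> B \<Longrightarrow> c \<le> h y" and x: "x \<in> Q"
  shows "c \<le> h x"
proof -
  have BQ: "B \<subseteq> Q" using Q(2) by (metis closure_subset hull_subset order_trans)
  have "closed Q" using Q(2) by (metis closed_closure)
  define K where "K = Q \<inter> h -` {c..}"
  have "closed K" unfolding K_def using h(1) \<open>closed Q\<close> by (rule continuous_closed_preimage) simp
  moreover have "convex K"
  proof (rule convexI)
    fix y z and u v :: real assume yz: "y \<in> K" "z \<in> K" "0 \<le> u" "0 \<le> v" "u + v = 1"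
    have "c = u * c + v * c" using yz by (simp flip: distrib_right)
    also have "\<dots> \<le> u * h y + v * h z" using yz by (intro add_mono mult_left_mono) (auto simp: K_def)
    also have "\<dots> = h (u *\<^sub>R y + v *\<^sub>R z)" using h(2) yz by (simp add: affine_fun_on_def K_def)
    finally show "u *\<^sub>R y + v *\<^sub>R z \<in> K" using yz convexD[OF Q(1), of y z u v] by (simp add: K_def)
  qed
  moreover have "B \<subseteq> K" using BQ ge by (auto simp: K_def)
  ultimately have "closure (convex hull B) \<subseteq> K" by (simp add: closure_minimal hull_minimal)
  then show ?thesis using x Q(2) by (auto simp: K_def)
qed

text \<open>Every point \<open>x\<close> of \<open>Q\<close> is the barycenter of a probability measure on \<open>X\<close>, which appears here as a
  positive functional \<open>L\<close>. Its linear extension \<open>l\<close> to \<open>C(X)\<close> is found below the sublinear functional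
  that assigns to \<open>g\<close> the infimum of \<open>h x\<close> over the affine majorants \<open>h\<close> of \<open>g\<close>. The estimate, which
  follows from the barycenter formula \<open>l (h \<circ> \<alpha>) = h x\<close>, is available for all continuous affine
  functions on \<open>Q\<close>; this matters because \<open>Q\<close> is acted upon by affine maps that need not extend to
  the ambient space.\<close>

lemma barycenter_functional:
  fixes Q :: "'v::locally_convex_space set" and \<alpha> :: "'x::t2_space \<Rightarrow> 'v"
  assumes X: "compact (UNIV :: 'x set)" and Q: "convex Q" "Q = closure (convex hull (range \<alpha>))"
    and \<alpha>: "continuous_on UNIV \<alpha>" and x: "x \<in> Q"
  obtains L where "cone_functional L"
    "\<And>h. continuous_on Q h \<Longrightarrow> affine_fun_on Q h \<Longrightarrow> \<bar>h x\<bar> \<le> L (\<lambda>z. \<bar>h (\<alpha> z)\<bar>)"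
proof -
  have \<alpha>Q: "\<alpha> z \<in> Q" for z using Q(2) by (metis closure_subset hull_subset order_trans rangeI subsetD)
  define A where "A = {h. continuous_on Q h \<and> affine_fun_on Q h}"
  define I where "I g = {h \<in> A. \<forall>z. apply_bcontfun g z \<le> h (\<alpha> z)}" for g :: "'x \<Rightarrow>\<^sub>C real"
  define P where "P g = (INF h\<in>I g. h x)" for g
  have const: "(\<lambda>_. c) \<in> A" for c by (simp add: A_def affine_fun_on_const)
  have ne: "I g \<noteq> {}" for g
  proof -
    have "(\<lambda>_. norm g) \<in> I g" using norm_bounded[of g] const by (force simp: I_def abs_le_iff)
    then show ?thesis by blast
  qed
  have ge: "c \<le> h x" if "h \<in> A" "\<And>z. c \<le> h (\<alpha> z)" for h c
    using that affine_fun_on_ge[OF Q, of h c x] x by (auto simp: A_def)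
  have "- norm g \<le> h x" if "h \<in> I g" for g h
  proof (rule ge)
    fix z
    have "apply_bcontfun g z \<le> h (\<alpha> z)" using that by (simp add: I_def)
    then show "- norm g \<le> h (\<alpha> z)" using norm_bounded[of g z] by (simp add: abs_le_iff)
  qed (use that in \<open>simp add: I_def\<close>)
  then have bdd: "bdd_below ((\<lambda>h. h x) ` I g)" for g by (intro bdd_belowI2)
  have P_le: "P g \<le> h x" if "h \<in> I g" for g h unfolding P_def by (rule cINF_lower[OF bdd that])
  have "sublinear P"
  proof (rule sublinearI)
    fix g k
    have sum_le: "P (g + k) \<le> h x + j x" if "h \<in> I g" "j \<in> I k" for h j
    proof (rule P_le)
      show "(\<lambda>x. h x + j x) \<in> I (g + k)"
        using that by (auto simp: I_def A_def affine_fun_on_add add_mono intro!: continuous_intros)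
    qed
    have "P (g + k) - h x \<le> P k" if "h \<in> I g" for h
      unfolding P_def[of k]
    proof (rule cINF_greatest[OF ne])
      fix j assume "j \<in> I k"
      from sum_le[OF that this] show "P (g + k) - h x \<le> j x" by simp
    qed
    then have "P (g + k) - P k \<le> P g"
      unfolding P_def[of g] by (intro cINF_greatest[OF ne]) (simp add: algebra_simps)
    then show "P (g + k) \<le> P g + P k" by simp
  next
    fix c :: real and g assume "0 < c"
    have "P (c *\<^sub>R g) \<le> c * h x" if "h \<in> I g" for h
    proof (rule P_le)
      show "(\<lambda>x. c * h x) \<in> I (c *\<^sub>R g)"
        using that \<open>0 < c\<close> by (auto simp: I_def A_def affine_fun_on_mult intro!: continuous_intros)
    qed
    then have "P (c *\<^sub>R g) / c \<le> P g" unfolding P_def[of g] using \<open>0 < c\<close>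
      by (intro cINF_greatest[OF ne]) (simp add: field_simps)
    then show "P (c *\<^sub>R g) \<le> c * P g" using \<open>0 < c\<close> by (simp add: field_simps)
  next
    have "P 0 \<le> 0" using P_le[of "\<lambda>_. 0" 0] const by (simp add: I_def)
    moreover have "0 \<le> P 0" unfolding P_def by (rule cINF_greatest[OF ne]) (auto simp: I_def intro: ge)
    ultimately show "P 0 = 0" by simp
  qed
  then obtain l where l: "linear l" "\<And>g. l g \<le> P g" using sublinear_dominates_linear by blast
  have pos: "0 \<le> l g" if "\<And>z. 0 \<le> apply_bcontfun g z" for g
  proof -
    have "(\<lambda>_. 0) \<in> I (- g)" using that const by (simp add: I_def)
    then have "l (- g) \<le> 0" using l(2)[of "- g"] P_le by fastforce
    then show ?thesis by (simp add: linear_neg[OF l(1)])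
  qed
  have bary: "l g = h x" if "h \<in> A" "\<And>z. apply_bcontfun g z = h (\<alpha> z)" for g h
  proof (rule antisym)
    show "l g \<le> h x" using l(2)[of g] P_le[of h g] that by (simp add: I_def)
    have "(\<lambda>x. -1 * h x) \<in> I (- g)"
      using that unfolding I_def A_def
      by (auto intro!: continuous_intros affine_fun_on_mult[of Q h "-1", simplified])
    from P_le[OF this] have "l (- g) \<le> - h x" using l(2)[of "- g"] by simp
    then show "h x \<le> l g" by (simp add: linear_neg[OF l(1)])
  qed
  have B: "apply_bcontfun (Bcontfun u) = u" if "continuous_on UNIV u" for u :: "'x \<Rightarrow> real"
    by (rule apply_Bcontfun[OF X that])
  show thesis
  proof (rule that[of "\<lambda>u. l (Bcontfun u)"])
    show "cone_functional (\<lambda>u. l (Bcontfun u))"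
    proof
      fix u v :: "'x \<Rightarrow> real" assume uv: "continuous_on UNIV u" "continuous_on UNIV v"
      have "Bcontfun (\<lambda>x. u x + v x) = Bcontfun u + Bcontfun v"
        using uv by (intro bcontfun_eqI) (simp add: B continuous_on_add)
      then show "l (Bcontfun (\<lambda>x. u x + v x)) = l (Bcontfun u) + l (Bcontfun v)"
        by (simp add: linear_add[OF l(1)])
    next
      fix u :: "'x \<Rightarrow> real" and c assume u: "continuous_on UNIV u"
      have "Bcontfun (\<lambda>x. c * u x) = c *\<^sub>R Bcontfun u"
        using u by (intro bcontfun_eqI) (simp add: B continuous_on_mult)
      then show "l (Bcontfun (\<lambda>x. c * u x)) = c * l (Bcontfun u)" by (simp add: linear_scale[OF l(1)])
    next
      fix u :: "'x \<Rightarrow> real" assume "continuous_on UNIV u" "\<And>x. 0 \<le> u x"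
      then show "0 \<le> l (Bcontfun u)" by (intro pos) (simp add: B)
    qed
    fix h assume h: "continuous_on Q h" "affine_fun_on Q h"
    have c: "continuous_on UNIV (\<lambda>z. h (\<alpha> z))"
      by (rule continuous_on_compose2[OF h(1) \<alpha>]) (use \<alpha>Q in auto)
    define g where "g = Bcontfun (\<lambda>z. h (\<alpha> z))"
    define k where "k = Bcontfun (\<lambda>z. \<bar>h (\<alpha> z)\<bar>)"
    have gk: "apply_bcontfun g z = h (\<alpha> z)" "apply_bcontfun k z = \<bar>h (\<alpha> z)\<bar>" for z
      unfolding g_def k_def using c by (simp_all add: B continuous_on_rabs)
    have "l g = h x" using h by (intro bary) (simp_all add: A_def gk)
    moreover have "0 \<le> l (k - g)" "0 \<le> l (k + g)" by (rule pos; simp add: gk)+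
    ultimately show "\<bar>h x\<bar> \<le> l (Bcontfun (\<lambda>z. \<bar>h (\<alpha> z)\<bar>))"
      by (simp add: linear_diff[OF l(1)] linear_add[OF l(1)] abs_le_iff flip: k_def)
  qed
qed

theorem tame_affine_E_compatible:
  fixes act :: "'s::semitopological_monoid \<Rightarrow> 'x::t2_space \<Rightarrow> 'x"
    and Q :: "'v::locally_convex_space set"
  assumes sys: "compact_system euclidean act" and tame: "tame euclidean act"
    and aff: "affine_compactification euclidean act Q actQ \<alpha>"
  shows "E_compatible euclidean (top_of_set Q) actQ \<alpha>"
proof (rule tame_E_compatible[OF sys tame, where H = "{l. linear l \<and> continuous_on UNIV l}"])
  have X: "compact (UNIV :: 'x set)" using sys by (simp add: compact_system_def compact_space_def)
  have act: "continuous_on UNIV (act s)" for s using sys by (simp add: compact_system_def)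
  have Q: "convex Q" "Q = closure (convex hull (range \<alpha>))"
    and eqv: "\<And>s x. \<alpha> (act s x) = actQ s (\<alpha> x)"
    and affQ: "\<And>s. affine_map_on Q (actQ s)"
    using aff unfolding affine_compactification_def topspace_euclidean by blast+
  have \<alpha>: "continuous_on UNIV \<alpha>" and \<alpha>Q: "\<alpha> x \<in> Q" for x
    using aff by (auto simp: affine_compactification_def continuous_map_in_subtopology)
  have actQ: "continuous_on Q (actQ s)" "actQ s ` Q \<subseteq> Q" for s
    using aff by (auto simp: affine_compactification_def compact_system_def continuous_map_in_subtopology)
  show "\<alpha> x \<in> topspace (top_of_set Q)" for x using \<alpha>Q by simp
  show "continuous_map (top_of_set Q) euclideanreal l" if "l \<in> {l. linear l \<and> continuous_on UNIV l}" for l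
    using that by (auto intro: continuous_on_subset)
  show "y = z" if "\<And>l. l \<in> {l. linear l \<and> continuous_on UNIV l} \<Longrightarrow> l y = (l z :: real)" for y z :: 'v
    using that locally_convex_separating_functional[of y z] by blast
  show "\<exists>f. continuous_on UNIV f \<and> (\<forall>s x. l (actQ s (\<alpha> x)) = f (act s x))"
    if "l \<in> {l. linear l \<and> continuous_on UNIV l}" for l :: "'v \<Rightarrow> real"
    using that \<alpha> by (intro exI[of _ "\<lambda>x. l (\<alpha> x)"]) (auto simp: eqv intro: continuous_on_compose2)
  fix l :: "'v \<Rightarrow> real" and y
  assume "l \<in> {l. linear l \<and> continuous_on UNIV l}" and y: "y \<in> topspace (top_of_set Q)"
  then have l: "linear l" "continuous_on UNIV l" by auto
  obtain L where L: "cone_functional L"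
    "\<And>h. continuous_on Q h \<Longrightarrow> affine_fun_on Q h \<Longrightarrow> \<bar>h y\<bar> \<le> L (\<lambda>z. \<bar>h (\<alpha> z)\<bar>)"
    using barycenter_functional[OF X Q \<alpha>, of y] y by auto
  have lc: "continuous_on Q (\<lambda>z. l (actQ s z))" for s
    by (rule continuous_on_compose2[OF l(2) actQ(1)]) auto
  have la: "affine_fun_on Q (\<lambda>z. l (actQ s z))" for s
    using affQ[of s] unfolding affine_fun_on_def affine_map_on_def
    by (auto simp: linear_add[OF l(1)] linear_scale[OF l(1)])
  have "\<bar>l (actQ s y) - l (actQ t y)\<bar> \<le> L (\<lambda>x. \<bar>l (actQ s (\<alpha> x)) - l (actQ t (\<alpha> x))\<bar>)" for s t
    using L(2)[of "\<lambda>z. l (actQ s z) + -1 * l (actQ t z)"]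
      affine_fun_on_add[OF la[of s] affine_fun_on_mult[OF la[of t], of "-1"]] lc[of s] lc[of t]
    by (simp add: continuous_on_diff)
  then show "\<exists>L. cone_functional L \<and> (\<forall>s t. \<bar>l (actQ s y) - l (actQ t y)\<bar> \<le>
      L (\<lambda>x. \<bar>l (actQ s (\<alpha> x)) - l (actQ t (\<alpha> x))\<bar>))"
    using L(1) by blast
qed


section \<open>Injectivity of tame systems\<close>

theorem theorem8p2:
  fixes act :: "'s::semitopological_monoid \<Rightarrow> 'x::t2_space \<Rightarrow> 'x"
  assumes "compact_system euclidean act"
    and "tame euclidean act"
  shows "injective_system act \<and>
    (\<forall>(Q :: 'v::locally_convex_space set) actQ (\<alpha> :: 'x \<Rightarrow> 'v).
       affine_compactification euclidean act Q actQ \<alpha> \<longrightarrow>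
       E_compatible euclidean (top_of_set Q) actQ \<alpha>)"
  using assms tame_WRUC tame_prob_E_compatible tame_affine_E_compatible
  by (auto simp: injective_system_def)

end
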